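(* The following is true. (1) $(G_2,G_4,G_6)$ is forcing on $(0,6]$. (2) $(G_2,G_5,G_{10}^{\#\#})$ is forcing on $[6,13]$. (3) $(G_2,G_5^{\flat},G_{10}^{\#})$ is forcing on $[13,15.05]$. (4) $(G_2,G_3,G_5)$ is forcing on $(-2,0)$.
   Context: $S^2$ is the unit sphere in $\mathbb{R}^3$. A $5$-point configuration is a set $P=\{P_1,\dots,P_5\}$ of $5$ distinct points of $S^2$. For $f:(0,2]\to\mathbb{R}$ the $f$-energy of $P$ is $\mathcal{E}_f(P)=\sum_{i<j}f(\|P_i-P_j\|)$, with Euclidean distance in $\mathbb{R}^3$; write $f(P)$ for $\mathcal{E}_f(P)$. The triangular bi-pyramid (TBP) is the configuration with one point at the north pole, one at the south pole, and three forming an equilateral triangle on the equator. $R_s(r)=\mathrm{sign}(s)\,r^{-s}$. $G_k(r)=(4-r^2)^k$, $G_5^{\flat}=G_5-25G_1$, $G_{10}^{\#}=G_{10}+13G_5+68G_2$, $G_{10}^{\#\#}=G_{10}+28G_5+102G_2$. A triple $(\Gamma_2,\Gamma_3,\Gamma_4)$ of potentials is forcing on an interval $I\subset\mathbb{R}$ if for every $5$-point configuration $X$: whenever $\Gamma_i(X)>\Gamma_i(\mathrm{TBP})$ for $i=2,3,4$, then $R_s(X)>R_s(\mathrm{TBP})$ for all $s\in I$. *)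

theory Defs
  imports "HOL-Analysis.Analysis"
begin

definition config5 :: "(real ^ 3) set \<Rightarrow> bool" where
  "config5 P \<longleftrightarrow> card P = 5 \<and> P \<subseteq> sphere 0 1"

text \<open>
  Configurations are unlabelled, so the sum over \<open>i < j\<close> is written as half of the sum over ordered
  pairs of distinct points; \<open>energy_enumeration\<close> recovers the labelled form.
  Potentials are total functions, of which only the values on \<open>(0, 2]\<close> are used.
\<close>
definition energy :: "(real \<Rightarrow> real) \<Rightarrow> (real ^ 3) set \<Rightarrow> real" where
  "energy f P = (\<Sum>x\<in>P. \<Sum>y\<in>P - {x}. f (dist x y)) / 2"

lemma energy_enumeration:
  fixes p :: "nat \<Rightarrow> real ^ 3"
  assumes "bij_betw p {..<n} P"
  shows "energy f P = (\<Sum>j<n. \<Sum>i<j. f (dist (p i) (p j)))"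
proof -
  have inj: "inj_on p {..<n}" and P: "P = p ` {..<n}"
    using assms by (auto simp: bij_betw_def)
  have inner: "(\<Sum>y\<in>P - {p i}. f (dist (p i) y)) = (\<Sum>j\<in>{..<n} - {i}. f (dist (p i) (p j)))"
    if "i < n" for i
  proof -
    have "P - {p i} = p ` ({..<n} - {i})"
      using inj that by (auto simp: P inj_on_def)
    then show ?thesis
      using inj by (simp add: sum.reindex inj_on_diff)
  qed
  have split: "(\<Sum>i<n. \<Sum>j\<in>{..<n} - {i}. g i j) = 2 * (\<Sum>j<n. \<Sum>i<j. g i j)"
    if sym: "\<And>i j. g i j = g j i" for g :: "nat \<Rightarrow> nat \<Rightarrow> real"
  proof (induction n)
    case (Suc n)
    have "(\<Sum>j\<in>{..<Suc n} - {i}. g i j) = (\<Sum>j\<in>{..<n} - {i}. g i j) + g i n" if "i < n" for i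
    proof -
      have "{..<Suc n} - {i} = insert n ({..<n} - {i})" using that by auto
      then show ?thesis by simp
    qed
    moreover have "{..<Suc n} - {n} = {..<n}" by auto
    ultimately show ?case
      using Suc by (simp add: sum.distrib sym[of n])
  qed simp
  have "(\<Sum>x\<in>P. \<Sum>y\<in>P - {x}. f (dist x y)) = (\<Sum>i<n. \<Sum>j\<in>{..<n} - {i}. f (dist (p i) (p j)))"
    using inj inner by (simp add: P sum.reindex)
  then show ?thesis
    by (simp add: energy_def split dist_commute)
qed

text \<open>
  The bi-pyramid is determined up to a rotation of the equator, which does not change energies;
  a fixed representative is used.
\<close>
definition TBP :: "(real ^ 3) set" where
  "TBP = {vector [0, 0, 1], vector [0, 0, -1],
          vector [1, 0, 0], vector [-1/2, sqrt 3 / 2, 0], vector [-1/2, - sqrt 3 / 2, 0]}"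

lemma config5_TBP: "config5 TBP"
  by (auto simp: config5_def TBP_def vec_eq_iff forall_3 norm_vec_def L2_set_def sum_3
      vector_3 power_divide)

definition R :: "real \<Rightarrow> real \<Rightarrow> real" where
  "R s r = sgn s * r powr (- s)"

definition G :: "nat \<Rightarrow> real \<Rightarrow> real" where
  "G k r = (4 - r\<^sup>2) ^ k"

definition G5_flat :: "real \<Rightarrow> real" where
  "G5_flat r = G 5 r - 25 * G 1 r"

definition G10_sharp :: "real \<Rightarrow> real" where
  "G10_sharp r = G 10 r + 13 * G 5 r + 68 * G 2 r"

definition G10_sharp2 :: "real \<Rightarrow> real" where
  "G10_sharp2 r = G 10 r + 28 * G 5 r + 102 * G 2 r"

definition forcing ::
  "(real \<Rightarrow> real) \<times> (real \<Rightarrow> real) \<times> (real \<Rightarrow> real) \<Rightarrow> real set \<Rightarrow> bool" where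
  "forcing = (\<lambda>(\<Gamma>2, \<Gamma>3, \<Gamma>4) I. \<forall>X. config5 X \<longrightarrow>
      energy \<Gamma>2 X > energy \<Gamma>2 TBP \<and> energy \<Gamma>3 X > energy \<Gamma>3 TBP \<and>
      energy \<Gamma>4 X > energy \<Gamma>4 TBP \<longrightarrow>
      (\<forall>s\<in>I. energy (R s) X > energy (R s) TBP))"

end

theory Submission imports Defs begin

text \<open>
  Put \<open>u = s / 2\<close> and \<open>x = 4 - r\<^sup>2\<close>. Then \<open>R s r = sgn s * (4 - x) powr (- u)\<close> and \<open>G k r = x ^ k\<close>
  with \<open>0 \<le> x < 4\<close>, and the ten distances of the bi-pyramid correspond to \<open>x = 2\<close> (six times),
  \<open>x = 1\<close> (three times) and \<open>x = 0\<close> (once). Suppose that a combination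
  \<open>c0 + c1 G\<^sub>1 + c2 \<Gamma>\<^sub>2 + c3 \<Gamma>\<^sub>3 + c4 \<Gamma>\<^sub>4\<close> with nonnegative \<open>c1, \<dots>, c4\<close>, of which one of the last
  three is positive, stays below \<open>R s\<close> and agrees with it at these three values of \<open>x\<close>. Summing over
  the pairs of a configuration that beats the bi-pyramid for the three \<open>\<Gamma>\<close> shows that it beats the
  bi-pyramid for \<open>R s\<close>; the term \<open>G\<^sub>1\<close> may be used because the bi-pyramid has the least \<open>G\<^sub>1\<close>-energy
  (\<open>interpolation_forces\<close>, \<open>energy_G1_ge\<close>).

  The combination is the Hermite interpolant of \<open>(4 - x) powr (- u)\<close> at the nodes \<open>0, 1, 1, 2, 2\<close>,
  taken from the span of \<open>1, x, x\<^sup>2, x\<^sup>p, x\<^sup>q\<close>, where \<open>(p, q)\<close> is \<open>(4, 6)\<close>, \<open>(5, 10)\<close>, \<open>(5, 10)\<close> and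
  \<open>(3, 5)\<close> in the four parts. Two things have to be shown: that the coefficients have the right sign
  and that the interpolant lies below. Both use one fact, which follows from Rolle's theorem: a
  function \<open>c + (p\<^sub>0 + p\<^sub>1 t) A\<^sup>t + (q\<^sub>0 + q\<^sub>1 t) B\<^sup>t\<close> that is not identically zero has at most four
  real zeros (\<open>exp_sum_zeros\<close>).

  As a function of \<open>u\<close>, each coefficient times \<open>4\<^sup>u\<close> is such a function with \<open>A = 4/3\<close> and \<open>B = 2\<close>.
  It tends to vanish at \<open>0\<close>, \<open>-1\<close> and \<open>-2\<close>, where the kernel itself lies in the span; further zeros
  are found by sign changes between explicit points. Once four zeros are located outside an
  interval, the sign on the interval is that of a single value (\<open>kexp_pos\<close>). A coefficient with too
  few visible zeros is either written as a sum of two functions that have four each, or estimated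
  from its power series.

  As a function of \<open>k\<close>, with \<open>x\<close> fixed, the error of interpolating \<open>x ^ k\<close> is \<open>x ^ k\<close> times such a
  function with \<open>A = 1/x\<close> and \<open>B = 2/x\<close>. It vanishes at \<open>k = 1, 2, p, q\<close>, so it does not change sign
  beyond \<open>q\<close> (\<open>power_error_nonneg\<close>). The kernel is a power series in \<open>x\<close> whose coefficients, the
  constant one excepted, all have the sign of \<open>u\<close>, so its interpolation error is a series in which
  only the few terms with \<open>k < q\<close> can have the wrong sign. These are outweighed by finitely many
  later terms, which is a polynomial inequality (\<open>kernel_error_46_nonneg\<close>,
  \<open>kernel_error_510_nonneg\<close>, \<open>kernel_error_35_nonpos\<close>).
\<close>

section \<open>Zeros of exponential sums\<close>

text \<open>
  The zeros of the derivative are chosen in the gaps between neighbouring zeros of \<open>f\<close>. The bound by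
  \<open>Max Z\<close> is what makes the induction work: the last gap lies to the right of all zeros found
  before.
\<close>
lemma Rolle_zero_count:
  fixes f f' :: "real \<Rightarrow> real"
  assumes der: "\<And>t. (f has_real_derivative f' t) (at t)"
  shows "finite Z \<Longrightarrow> card Z = Suc n \<Longrightarrow> (\<And>z. z \<in> Z \<Longrightarrow> f z = 0) \<Longrightarrow>
    \<exists>Z'. finite Z' \<and> card Z' = n \<and> (\<forall>z\<in>Z'. f' z = 0 \<and> z < Max Z)"
proof (induction n arbitrary: Z)
  case 0
  show ?case by (rule exI[of _ "{}"]) simp
next
  case (Suc n)
  define m where "m = Max Z"
  define Y where "Y = Z - {m}"
  have "Z \<noteq> {}" using Suc.prems by auto
  then have m: "m \<in> Z" unfolding m_def using Suc.prems by simp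
  have Y: "finite Y" "card Y = Suc n" "\<And>z. z \<in> Y \<Longrightarrow> f z = 0"
    using Suc.prems m by (auto simp: Y_def)
  then have "Y \<noteq> {}" by auto
  then have mY: "Max Y \<in> Y" using Y by simp
  have less: "Max Y < m"
  proof -
    have "Max Y \<in> Z" "Max Y \<noteq> m" using mY by (auto simp: Y_def)
    moreover have "Max Y \<le> m" unfolding m_def using \<open>Max Y \<in> Z\<close> Suc.prems by simp
    ultimately show ?thesis by linarith
  qed
  obtain Z' where Z': "finite Z'" "card Z' = n" "\<forall>z\<in>Z'. f' z = 0 \<and> z < Max Y"
    using Suc.IH[OF Y] by blast
  obtain z where z: "Max Y < z" "z < m" "(f has_real_derivative 0) (at z)"
  proof -
    have "f (Max Y) = f m" using Y(3)[OF mY] Suc.prems(3)[OF m] by simp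
    then show thesis
      using Rolle[OF less, of f] der that
      by (metis DERIV_isCont continuous_at_imp_continuous_on real_differentiable_def)
  qed
  have "f' z = 0" using z(3) der DERIV_unique by blast
  moreover have "z \<notin> Z'" using Z'(3) z(1) by fastforce
  ultimately show ?case
    using Z' z less unfolding m_def[symmetric]
    by (intro exI[of _ "insert z Z'"]) auto
qed

definition exp_sum :: "real \<Rightarrow> real \<Rightarrow> real \<Rightarrow> real \<Rightarrow> real \<Rightarrow> real \<Rightarrow> real \<Rightarrow> real \<Rightarrow> real"
  where "exp_sum a b c p0 p1 q0 q1 t = c + (p0 + p1 * t) * exp (a * t) + (q0 + q1 * t) * exp (b * t)"

text \<open>
  One derivative removes \<open>c\<close>; after division by \<open>exp (a t)\<close>, two more remove the linear polynomial
  that is left without exponential factor. What remains is a linear polynomial times an exponential,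
  with two zeros if there were five at the start, so it vanishes, and the coefficients are recovered
  backwards.
\<close>
lemma exp_sum_zeros:
  assumes ab: "a \<noteq> 0" "b \<noteq> 0" "a \<noteq> b"
    and Z: "finite Z" "5 \<le> card Z" "\<And>z. z \<in> Z \<Longrightarrow> exp_sum a b c p0 p1 q0 q1 z = 0"
  shows "exp_sum a b c p0 p1 q0 q1 t = 0"
proof -
  obtain Z0 where Z0: "Z0 \<subseteq> Z" "card Z0 = 5" "finite Z0"
    using Z(1,2) by (meson obtain_subset_with_card_n finite_subset)
  define P0 P1 Q0 Q1 where "P0 = p1 + a * p0" "P1 = a * p1" "Q0 = q1 + b * q0" "Q1 = b * q1"
  note defs = this
  define d where "d = b - a"
  have d: "d \<noteq> 0" using ab by (simp add: d_def)
  have "(exp_sum a b c p0 p1 q0 q1 has_real_derivative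
      (P0 + P1 * t) * exp (a * t) + (Q0 + Q1 * t) * exp (b * t)) (at t)" for t
    unfolding exp_sum_def defs by (auto intro!: derivative_eq_intros simp: algebra_simps)
  from Rolle_zero_count[OF this, of Z0 4] obtain Z1 where Z1: "finite Z1" "card Z1 = 4"
    "\<forall>z\<in>Z1. (P0 + P1 * z) * exp (a * z) + (Q0 + Q1 * z) * exp (b * z) = 0 \<and> z < Max Z0"
    using Z0 Z(3) by auto
  have Z1': "P0 + P1 * z + (Q0 + Q1 * z) * exp (d * z) = 0" if "z \<in> Z1" for z
  proof -
    have "exp (b * z) = exp (a * z) * exp (d * z)"
      by (simp add: d_def flip: exp_add) (simp add: algebra_simps)
    then have "exp (a * z) * (P0 + P1 * z + (Q0 + Q1 * z) * exp (d * z)) = 0"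
      using bspec[OF Z1(3) that] by (simp add: distrib_left distrib_right mult_ac)
    then show ?thesis by simp
  qed
  have "((\<lambda>t. P0 + P1 * t + (Q0 + Q1 * t) * exp (d * t)) has_real_derivative
      P1 + (Q1 + d * Q0 + d * Q1 * t) * exp (d * t)) (at t)" for t
    by (auto intro!: derivative_eq_intros simp: algebra_simps)
  from Rolle_zero_count[OF this, of Z1 3] obtain Z2 where Z2: "finite Z2" "card Z2 = 3"
    "\<forall>z\<in>Z2. P1 + (Q1 + d * Q0 + d * Q1 * z) * exp (d * z) = 0 \<and> z < Max Z1"
    using Z1(1,2) Z1' by auto
  have "((\<lambda>t. P1 + (Q1 + d * Q0 + d * Q1 * t) * exp (d * t)) has_real_derivative
      d * (2 * Q1 + d * Q0 + d * Q1 * t) * exp (d * t)) (at t)" for t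
    by (auto intro!: derivative_eq_intros simp: algebra_simps)
  from Rolle_zero_count[OF this, of Z2 2] obtain Z3 where Z3: "finite Z3" "card Z3 = 2"
    "\<forall>z\<in>Z3. d * (2 * Q1 + d * Q0 + d * Q1 * z) * exp (d * z) = 0 \<and> z < Max Z2"
    using Z2 by auto
  obtain y z where yz: "y \<in> Z3" "z \<in> Z3" "y \<noteq> z"
    using Z3(2) by (auto simp: card_2_iff)
  have lin: "2 * Q1 + d * Q0 + d * Q1 * y = 0" "2 * Q1 + d * Q0 + d * Q1 * z = 0"
    using bspec[OF Z3(3) yz(1)] bspec[OF Z3(3) yz(2)] d by auto
  then have "d * Q1 * y = d * Q1 * z" by linarith
  then have "Q1 = 0" using d yz by simp
  then have "Q0 = 0" using lin d by simp
  obtain w where "w \<in> Z2" using Z2(2) by fastforce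
  then have "P1 = 0" using Z2(3) \<open>Q0 = 0\<close> \<open>Q1 = 0\<close> by fastforce
  obtain w where "w \<in> Z1" using Z1(2) by fastforce
  then have "P0 = 0" using Z1' \<open>Q0 = 0\<close> \<open>Q1 = 0\<close> \<open>P1 = 0\<close> by fastforce
  have "p1 = 0" "p0 = 0" "q1 = 0" "q0 = 0"
    using defs ab \<open>P0 = 0\<close> \<open>P1 = 0\<close> \<open>Q0 = 0\<close> \<open>Q1 = 0\<close> by auto
  moreover obtain w where "w \<in> Z0" using Z0(2) by fastforce
  ultimately show ?thesis using Z(3)[of w] Z0(1) by (auto simp: exp_sum_def)
qed

lemma continuous_exp_sum: "continuous_on S (exp_sum a b c p0 p1 q0 q1)"
  unfolding exp_sum_def by (intro continuous_intros)

lemma exp_sum_sign_change: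
  assumes "exp_sum a b c p0 p1 q0 q1 x * exp_sum a b c p0 p1 q0 q1 y < 0" "x < y"
  shows "\<exists>z\<in>{x<..<y}. exp_sum a b c p0 p1 q0 q1 z = 0"
proof -
  let ?h = "exp_sum a b c p0 p1 q0 q1"
  have "\<exists>z\<ge>x. z \<le> y \<and> ?h z = 0"
  proof (cases "?h x < 0")
    case True
    then show ?thesis using assms IVT'[of ?h x 0 y] continuous_exp_sum
      by (simp add: mult_less_0_iff)
  next
    case False
    then show ?thesis using assms IVT2'[of ?h y 0 x] continuous_exp_sum
      by (simp add: mult_less_0_iff)
  qed
  then obtain z where z: "x \<le> z" "z \<le> y" "?h z = 0" by blast
  moreover have "z \<noteq> x" "z \<noteq> y" using assms z by auto
  ultimately show ?thesis by force
qed

text \<open>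
  A nonpositive value in \<open>I\<close> would give, by continuity, a fifth zero in \<open>I\<close>.
\<close>
lemma exp_sum_pos:
  assumes ab: "a \<noteq> 0" "b \<noteq> 0" "a \<noteq> b"
    and I: "is_interval I" "w \<in> I" "0 < exp_sum a b c p0 p1 q0 q1 w"
    and zeros: "\<And>S. S \<in> {S1, S2, S3, S4} \<Longrightarrow> \<exists>z\<in>S. exp_sum a b c p0 p1 q0 q1 z = 0"
    and disj: "S1 \<inter> S2 = {}" "S1 \<inter> S3 = {}" "S1 \<inter> S4 = {}" "S2 \<inter> S3 = {}" "S2 \<inter> S4 = {}"
      "S3 \<inter> S4 = {}" "I \<inter> (S1 \<union> S2 \<union> S3 \<union> S4) = {}"
    and t: "t \<in> I"
  shows "0 < exp_sum a b c p0 p1 q0 q1 t"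
proof (rule ccontr)
  let ?h = "exp_sum a b c p0 p1 q0 q1"
  assume "\<not> 0 < ?h t"
  then have "0 \<in> {?h t..?h w}" using I by simp
  moreover have "connected (?h ` I)"
    using I(1) continuous_exp_sum by (intro connected_continuous_image is_interval_connected)
  ultimately obtain z where z: "z \<in> I" "?h z = 0"
    using t I(2) connected_contains_Icc[of "?h ` I" "?h t" "?h w"] by fastforce
  obtain z1 z2 z3 z4 where zz: "z1 \<in> S1" "?h z1 = 0" "z2 \<in> S2" "?h z2 = 0"
    "z3 \<in> S3" "?h z3 = 0" "z4 \<in> S4" "?h z4 = 0"
    using zeros by (metis insertCI)
  have "z \<notin> {z1, z2, z3, z4}" "z1 \<notin> {z2, z3, z4}" "z2 \<notin> {z3, z4}" "z3 \<noteq> z4"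
    using zz(1,3,5,7) z(1) disj by blast+
  then have "5 \<le> card {z, z1, z2, z3, z4}" by simp
  moreover have "?h y = 0" if "y \<in> {z, z1, z2, z3, z4}" for y
    using that z(2) zz(2,4,6,8) by blast
  ultimately have "?h w = 0"
    using exp_sum_zeros[OF ab, of "{z, z1, z2, z3, z4}"] by blast
  then show False using I by simp
qed

section \<open>Hermite data of powers and of the Riesz kernel\<close>

text \<open>
  A quadruple stands for the functional
  \<open>f \<mapsto> m1 * (f 1 - f 0) + m2 * f' 1 + m3 * (f 2 - f 0) + m4 * f' 2\<close>; the coefficients of \<open>x\<close>, \<open>x\<^sup>2\<close>,
  \<open>x\<^sup>p\<close>, \<open>x\<^sup>q\<close> in a Hermite interpolant at \<open>0, 1, 1, 2, 2\<close> are of this form. The value on the power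
  \<open>x ^ k\<close>, for \<open>k \<ge> 1\<close>, is \<open>on_power m k\<close>, and the value on \<open>(1 - x / 4) powr (- u)\<close>, the kernel
  scaled by \<open>4 powr u\<close>, is \<open>on_kernel m u\<close>: that function has the values \<open>(4/3) powr u\<close> and
  \<open>2 powr u\<close> at \<open>1\<close> and \<open>2\<close>, and the derivatives \<open>u / 3 * (4/3) powr u\<close> and \<open>u / 2 * 2 powr u\<close>.
\<close>
type_synonym functional = "real \<times> real \<times> real \<times> real"

definition on_power :: "functional \<Rightarrow> nat \<Rightarrow> real" where
  "on_power = (\<lambda>(m1, m2, m3, m4) k. m1 + m2 * k + m3 * 2 ^ k + m4 * k * 2 ^ k / 2)"

definition on_kernel :: "functional \<Rightarrow> real \<Rightarrow> real" where
  "on_kernel = (\<lambda>(m1, m2, m3, m4) u.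
     exp_sum (ln (4 / 3)) (ln 2) (- (m1 + m3)) m1 (m2 / 3) m3 (m4 / 2) u)"

text \<open>
  The Taylor coefficients of \<open>(1 - x / 4) powr (- u) - 1\<close>. The constant term is removed because the
  functionals only see differences from the value at \<open>0\<close>.
\<close>
definition kernel_coeff :: "real \<Rightarrow> nat \<Rightarrow> real" where
  "kernel_coeff u k = (if k = 0 then 0 else pochhammer u k / (fact k * 4 ^ k))"

lemma binomial_series:
  fixes u y :: real
  assumes "\<bar>y\<bar> < 1"
  shows "(\<lambda>k. pochhammer u k / fact k * y ^ k) sums (1 - y) powr (- u)"
proof -
  have "(\<lambda>k. ((- u) gchoose k) * (- y) ^ k) sums (1 + - y) powr (- u)"
    using assms by (intro gen_binomial_real) simp
  moreover have "((- u) gchoose k) * (- y) ^ k = pochhammer u k / fact k * y ^ k" for k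
  proof -
    have "((- u) gchoose k) * (- y) ^ k = ((- 1) ^ k * (- 1) ^ k) * (pochhammer u k / fact k * y ^ k)"
      unfolding gbinomial_pochhammer power_minus[of y k] by simp
    also have "(- 1) ^ k * (- 1) ^ k = (1 :: real)" by (simp flip: power_mult_distrib)
    finally show ?thesis by simp
  qed
  ultimately show ?thesis by simp
qed

lemma binomial_series_derivative:
  fixes u y :: real
  assumes "\<bar>y\<bar> < 1"
  shows "(\<lambda>k. pochhammer u k / fact k * k * y ^ k) sums (u * y * (1 - y) powr (- u - 1))"
proof -
  have eq: "pochhammer u (Suc k) / fact (Suc k) * real (Suc k) * y ^ Suc k =
      u * y * (pochhammer (u + 1) k / fact k * y ^ k)" for k
    by (simp add: pochhammer_rec divide_simps del: of_nat_Suc)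
  have "(\<lambda>k. u * y * (pochhammer (u + 1) k / fact k * y ^ k)) sums
      (u * y * (1 - y) powr (- (u + 1)))"
    by (intro sums_mult binomial_series assms)
  then have "(\<lambda>k. pochhammer u (Suc k) / fact (Suc k) * real (Suc k) * y ^ Suc k) sums
      (u * y * (1 - y) powr (- u - 1))"
    unfolding eq by simp
  then show ?thesis
    by (subst (asm) sums_Suc_iff) simp
qed

lemma kernel_series:
  fixes u x :: real
  assumes "0 \<le> x" "x < 4"
  shows "(\<lambda>k. kernel_coeff u k * x ^ k) sums ((1 - x / 4) powr (- u) - 1)"
    and "(\<lambda>k. kernel_coeff u k * (k * x ^ k)) sums (u * (x / 4) * (1 - x / 4) powr (- u - 1))"
proof -
  have y: "\<bar>x / 4\<bar> < 1" using assms by simp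
  have "(\<lambda>k. pochhammer u k / fact k * (x / 4) ^ k - (if k = 0 then 1 else 0)) sums
      ((1 - x / 4) powr (- u) - 1)"
    by (intro sums_diff binomial_series[OF y] sums_single)
  also have "(\<lambda>k. pochhammer u k / fact k * (x / 4) ^ k - (if k = 0 then 1 else 0)) =
      (\<lambda>k. kernel_coeff u k * x ^ k)"
    by (auto simp: kernel_coeff_def fun_eq_iff power_divide)
  finally show "(\<lambda>k. kernel_coeff u k * x ^ k) sums ((1 - x / 4) powr (- u) - 1)" .
  have "(\<lambda>k. kernel_coeff u k * (k * x ^ k)) = (\<lambda>k. pochhammer u k / fact k * k * (x / 4) ^ k)"
    by (auto simp: kernel_coeff_def fun_eq_iff power_divide)
  then show "(\<lambda>k. kernel_coeff u k * (k * x ^ k)) sums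
      (u * (x / 4) * (1 - x / 4) powr (- u - 1))"
    using binomial_series_derivative[OF y] by simp
qed

lemma on_kernel_sums: "(\<lambda>k. kernel_coeff u k * on_power m k) sums on_kernel m u"
proof -
  obtain m1 m2 m3 m4 where m: "m = (m1, m2, m3, m4)" by (cases m)
  let ?A = "exp (ln (4 / 3) * u)" and ?B = "exp (ln 2 * u)"
  have A: "(1 - 1 / 4 :: real) powr (- u) = ?A" "(1 - 1 / 4 :: real) powr (- u - 1) = 4 / 3 * ?A"
    by (simp_all add: powr_def ln_div algebra_simps exp_add exp_diff exp_minus)
  have B: "(1 - 2 / 4 :: real) powr (- u) = ?B" "(1 - 2 / 4 :: real) powr (- u - 1) = 2 * ?B"
    by (simp_all add: powr_def ln_div algebra_simps exp_add exp_diff exp_minus)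
  have "(\<lambda>k. m1 * (kernel_coeff u k * 1 ^ k) + m2 * (kernel_coeff u k * (k * 1 ^ k)) +
      m3 * (kernel_coeff u k * 2 ^ k) + m4 / 2 * (kernel_coeff u k * (k * 2 ^ k))) sums
    (m1 * (?A - 1) + m2 * (u * (1 / 4) * (4 / 3 * ?A)) +
      m3 * (?B - 1) + m4 / 2 * (u * (2 / 4) * (2 * ?B)))"
    using kernel_series[of 1 u] kernel_series[of 2 u] unfolding A B
    by (intro sums_add sums_mult) simp_all
  then show ?thesis
    by (simp add: m on_power_def on_kernel_def exp_sum_def algebra_simps)
qed

text \<open>
  A scheme lists the exponents of the interpolating span (except \<open>0\<close>) with the functionals that give
  their coefficients. The errors are those of interpolating \<open>x ^ k\<close>, for \<open>k \<ge> 1\<close>, and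
  \<open>(1 - x / 4) powr (- u)\<close>.
\<close>
definition power_error :: "(nat \<times> functional) list \<Rightarrow> nat \<Rightarrow> real \<Rightarrow> real" where
  "power_error L k x = x ^ k - (\<Sum>(e, m)\<leftarrow>L. on_power m k * x ^ e)"

definition kernel_error :: "(nat \<times> functional) list \<Rightarrow> real \<Rightarrow> real \<Rightarrow> real" where
  "kernel_error L u x = (1 - x / 4) powr (- u) - 1 - (\<Sum>(e, m)\<leftarrow>L. on_kernel m u * x ^ e)"

text \<open>
  Interpolation commutes with summing the Taylor series, because the functionals only use values and
  derivatives inside the disc of convergence.
\<close>
lemma kernel_error_sums:
  fixes u x :: real
  assumes "0 \<le> x" "x < 4"
  shows "(\<lambda>k. kernel_coeff u k * power_error L k x) sums kernel_error L u x"
proof -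
  have "(\<lambda>k. kernel_coeff u k * (\<Sum>(e, m)\<leftarrow>L. on_power m k * x ^ e)) sums
      (\<Sum>(e, m)\<leftarrow>L. on_kernel m u * x ^ e)"
  proof (induction L)
    case (Cons p L)
    obtain e m where p: "p = (e, m)" by (cases p)
    have "(\<lambda>k. kernel_coeff u k * on_power m k * x ^ e +
        kernel_coeff u k * (\<Sum>(e, m)\<leftarrow>L. on_power m k * x ^ e)) sums
      (on_kernel m u * x ^ e + (\<Sum>(e, m)\<leftarrow>L. on_kernel m u * x ^ e))"
      by (intro sums_add sums_mult2 on_kernel_sums Cons.IH)
    then show ?case by (simp add: p algebra_simps)
  qed simp
  then show ?thesis
    using sums_diff[OF kernel_series(1)[OF assms, of u]]
    by (simp add: power_error_def kernel_error_def right_diff_distrib)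
qed

text \<open>
  For fixed \<open>x\<close> the error, divided by \<open>x ^ k\<close>, is an exponential sum in a real variable \<open>k\<close>. The
  four elements of \<open>N\<close> are all its zeros, so the sign at \<open>r\<close> persists. The values \<open>1\<close> and \<open>2\<close> of \<open>x\<close>
  are excluded since there two of the three exponentials coincide.
\<close>
lemma power_error_nonneg:
  fixes x :: real
  assumes x: "0 < x" "x \<noteq> 1" "x \<noteq> 2"
    and N: "finite N" "card N = 4" "\<And>n. n \<in> N \<Longrightarrow> n < r \<and> power_error L n x = 0"
    and r: "0 < power_error L r x" "r \<le> k"
  shows "0 \<le> power_error L k x"
proof (rule ccontr)
  assume neg: "\<not> 0 \<le> power_error L k x"
  define a b where "a = - ln x" and "b = ln 2 - ln x"
  have ab: "a \<noteq> 0" "b \<noteq> 0" "a \<noteq> b" using x by (auto simp: a_def b_def)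
  have "\<exists>l0 l1 l2 l3 :: real. \<forall>k. (\<Sum>(e, m)\<leftarrow>L. on_power m k * x ^ e) =
      l0 + l1 * k + (l2 + l3 * k) * 2 ^ k"
  proof (induction L)
    case Nil
    show ?case by (rule exI[of _ 0])+ simp
  next
    case (Cons p L)
    then obtain l0 l1 l2 l3 :: real where l: "\<And>k. (\<Sum>(e, m)\<leftarrow>L. on_power m k * x ^ e) =
      l0 + l1 * k + (l2 + l3 * k) * 2 ^ k" by blast
    obtain e m1 m2 m3 m4 where p: "p = (e, m1, m2, m3, m4)" by (cases p)
    have "(\<Sum>(e, m)\<leftarrow>p # L. on_power m k * x ^ e) =
        (m1 + m2 * k + m3 * 2 ^ k + m4 * k * 2 ^ k / 2) * x ^ e + (l0 + l1 * k + (l2 + l3 * k) * 2 ^ k)"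
      for k unfolding l[symmetric] by (simp add: p on_power_def)
    then show ?case
      by (intro exI[of _ "l0 + m1 * x ^ e"] exI[of _ "l1 + m2 * x ^ e"]
          exI[of _ "l2 + m3 * x ^ e"] exI[of _ "l3 + m4 / 2 * x ^ e"]) (simp add: algebra_simps)
  qed
  then obtain l0 l1 l2 l3 :: real where l: "\<And>k. (\<Sum>(e, m)\<leftarrow>L. on_power m k * x ^ e) =
      l0 + l1 * k + (l2 + l3 * k) * 2 ^ k" by blast
  define h where "h = exp_sum a b 1 (- l0) (- l1) (- l2) (- l3)"
  have h: "power_error L k x = x ^ k * h (real k)" for k
  proof -
    have "exp (a * k) = 1 / x ^ k" "exp (b * k) = 2 ^ k / x ^ k"
      using x by (simp_all add: a_def b_def left_diff_distrib exp_diff exp_minus inverse_eq_divide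
          mult.commute[of _ "real k"] exp_of_nat_mult power_divide)
    then have "h (real k) = 1 - (l0 + l1 * k) / x ^ k - (l2 + l3 * k) * 2 ^ k / x ^ k"
      by (simp add: h_def exp_sum_def diff_divide_distrib add_divide_distrib algebra_simps)
    moreover have "x ^ k \<noteq> 0" using x by simp
    ultimately show ?thesis
      by (simp add: power_error_def l right_diff_distrib)
  qed
  have "0 < h (real r)" "h (real k) < 0"
    using r(1) neg x unfolding h by (simp_all add: zero_less_mult_iff not_le mult_less_0_iff)
  then have "h (real r) * h (real k) < 0" by (rule mult_pos_neg)
  moreover have "real r < real k"
    using r neg by (cases "r = k") auto
  ultimately obtain z where z: "real r < z" "h z = 0"
    using exp_sum_sign_change[of a b 1 "- l0" "- l1" "- l2" "- l3" "real r" "real k"]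
    unfolding h_def by auto
  have "h (real n) = 0" if "n \<in> N" for n
    using N(3)[OF that] x unfolding h by simp
  then have "h y = 0" if "y \<in> insert z (real ` N)" for y
    using that z(2) by blast
  moreover have "5 \<le> card (insert z (real ` N))"
  proof -
    have "z \<notin> real ` N" using z N(3) by fastforce
    then show ?thesis using N(1,2) by (simp add: card_image)
  qed
  ultimately have "h (real r) = 0"
    using exp_sum_zeros[OF ab, of "insert z (real ` N)"] N(1) unfolding h_def by blast
  then show False using r(1) unfolding h by simp
qed

lemma sum_le_sums:
  fixes f :: "nat \<Rightarrow> real"
  assumes "f sums s" "finite S" "\<And>k. k \<notin> S \<Longrightarrow> 0 \<le> f k"
  shows "sum f S \<le> s"
proof -
  have "sum f S \<le> suminf f"
    using assms by (intro sum_le_suminf) (auto dest: sums_summable)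
  then show ?thesis using sums_unique[OF assms(1)] by simp
qed

lemma kernel_coeff_Suc:
  assumes "1 \<le> k"
  shows "kernel_coeff u (Suc k) = kernel_coeff u k * (u + k) / (4 * (real k + 1))"
  using assms by (simp add: kernel_coeff_def pochhammer_Suc mult_ac add_ac)

lemma kernel_coeff_nonneg:
  assumes "0 < u"
  shows "0 \<le> kernel_coeff u k"
  using pochhammer_nonneg[OF assms, of k] by (simp add: kernel_coeff_def)

lemma kernel_coeff_0: "kernel_coeff u 0 = 0"
  by (simp add: kernel_coeff_def)

lemma kernel_coeff_pos:
  assumes "0 < u" "1 \<le> k"
  shows "0 < kernel_coeff u k"
  using assms by (simp add: kernel_coeff_def pochhammer_pos)

lemma kernel_coeff_neg:
  assumes "- 1 < u" "u < 0" "1 \<le> k"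
  shows "kernel_coeff u k < 0"
proof -
  obtain n where n: "k = Suc n" using assms(3) by (cases k) auto
  have "0 < pochhammer (u + 1) n" using assms by (intro pochhammer_pos) simp
  then show ?thesis using assms
    by (simp add: kernel_coeff_def n pochhammer_rec mult_neg_pos divide_neg_pos)
qed

lemma kernel_coeff_nonpos:
  assumes "- 1 < u" "u < 0"
  shows "kernel_coeff u k \<le> 0"
  using kernel_coeff_neg[OF assms, of k] by (cases "k = 0") (auto simp: kernel_coeff_0)

section \<open>Energies and interpolation from below\<close>

lemma energy_linear:
  "energy (\<lambda>r. f r + g r) X = energy f X + energy g X"
  "energy (\<lambda>r. c * f r) X = c * energy f X"
  by (simp_all add: energy_def sum.distrib sum_distrib_left add_divide_distrib)

lemma energy_const:
  assumes "config5 X"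
  shows "energy (\<lambda>r. c) X = 10 * c"
proof -
  have X: "finite X" "card X = 5"
    using assms by (auto simp: config5_def intro: card_ge_0_finite)
  then have "(\<Sum>y\<in>X - {x}. c) = 4 * c" if "x \<in> X" for x
    using that by simp
  then show ?thesis using X by (simp add: energy_def)
qed

lemma energy_mono:
  assumes "config5 X" "\<And>r. 0 < r \<Longrightarrow> r \<le> 2 \<Longrightarrow> f r \<le> g r"
  shows "energy f X \<le> energy g X"
proof -
  have "f (dist x y) \<le> g (dist x y)" if "x \<in> X" "y \<in> X - {x}" for x y
  proof (rule assms(2))
    show "0 < dist x y" using that by auto
    have "norm x = 1" "norm y = 1" using that assms(1) by (auto simp: config5_def)
    then show "dist x y \<le> 2" using norm_triangle_ineq4[of x y] by (simp add: dist_norm)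
  qed
  then show ?thesis unfolding energy_def by (intro divide_right_mono sum_mono) auto
qed

text \<open>
  Since \<open>G 1 (dist x y) = 2 + 2 * (x \<bullet> y)\<close> on the sphere, the energy is \<open>15\<close> plus the squared norm
  of the sum of the five points.
\<close>
lemma energy_G1_ge:
  assumes "config5 X"
  shows "15 \<le> energy (G 1) X"
proof -
  have X: "finite X" "card X = 5" "\<And>x. x \<in> X \<Longrightarrow> norm x = 1"
    using assms by (auto simp: config5_def intro: card_ge_0_finite)
  have "(\<Sum>y\<in>X - {x}. G 1 (dist x y)) = (\<Sum>y\<in>X. 2 + 2 * (x \<bullet> y)) - 4" if "x \<in> X" for x
  proof -
    have "G 1 (dist x y) = 2 + 2 * (x \<bullet> y)" if "y \<in> X" for y
    proof -
      have "x \<bullet> x = 1" "y \<bullet> y = 1"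
        using X(3) \<open>x \<in> X\<close> that by (simp_all add: norm_eq_1)
      then show ?thesis
        by (simp add: G_def dist_norm power2_norm_eq_inner inner_diff inner_commute)
    qed
    moreover have "x \<bullet> x = 1" using X(3) that by (simp add: norm_eq_1)
    ultimately show ?thesis using that X(1) by (simp add: sum_diff1)
  qed
  then have "(\<Sum>x\<in>X. \<Sum>y\<in>X - {x}. G 1 (dist x y)) = (\<Sum>x\<in>X. (\<Sum>y\<in>X. 2 + 2 * (x \<bullet> y)) - 4)"
    by simp
  also have "\<dots> = 30 + 2 * (\<Sum>x\<in>X. \<Sum>y\<in>X. x \<bullet> y)"
    using X(2) by (simp add: sum_subtractf sum.distrib flip: sum_distrib_left)
  also have "(\<Sum>x\<in>X. \<Sum>y\<in>X. x \<bullet> y) = \<Sum>X \<bullet> \<Sum>X"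
    by (simp only: inner_sum_left) (simp only: inner_sum_right)
  finally show ?thesis by (simp add: energy_def)
qed

lemma energy_TBP: "energy f TBP = 6 * f (sqrt 2) + 3 * f (sqrt 3) + f 2"
proof -
  define p :: "nat \<Rightarrow> real ^ 3" where
    "p = (!) [vector [0, 0, 1], vector [0, 0, -1], vector [1, 0, 0],
      vector [-1/2, sqrt 3 / 2, 0], vector [-1/2, - sqrt 3 / 2, 0]]"
  have img: "p ` {..<5} = TBP"
    by (auto simp: p_def TBP_def lessThan_nat_numeral lessThan_Suc)
  moreover have "card (p ` {..<5}) = 5"
    using config5_TBP by (simp add: img config5_def)
  ultimately have bij: "bij_betw p {..<5} TBP"
    by (simp add: bij_betw_def eq_card_imp_inj_on)
  have "dist (p 0) (p 1) = 2" "dist (p 0) (p 2) = sqrt 2" "dist (p 0) (p 3) = sqrt 2"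
    "dist (p 0) (p 4) = sqrt 2" "dist (p 1) (p 2) = sqrt 2" "dist (p 1) (p 3) = sqrt 2"
    "dist (p 1) (p 4) = sqrt 2" "dist (p 2) (p 3) = sqrt 3" "dist (p 2) (p 4) = sqrt 3"
    "dist (p 3) (p 4) = sqrt 3"
    by (simp_all add: p_def dist_norm norm_vec_def L2_set_def sum_3 power_divide real_sqrt_divide)
  then show ?thesis
    unfolding energy_enumeration[OF bij] by (simp add: lessThan_nat_numeral lessThan_Suc)
qed

lemma interpolation_forces:
  fixes f \<Gamma>2 \<Gamma>3 \<Gamma>4 :: "real \<Rightarrow> real"
  assumes X: "config5 X"
    and below: "\<And>r. 0 < r \<Longrightarrow> r \<le> 2 \<Longrightarrow>
      c0 + c1 * G 1 r + c2 * \<Gamma>2 r + c3 * \<Gamma>3 r + c4 * \<Gamma>4 r \<le> f r"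
    and touch: "\<And>r. r \<in> {sqrt 2, sqrt 3, 2} \<Longrightarrow>
      c0 + c1 * G 1 r + c2 * \<Gamma>2 r + c3 * \<Gamma>3 r + c4 * \<Gamma>4 r = f r"
    and c: "0 \<le> c1" "0 \<le> c2" "0 \<le> c3" "0 \<le> c4" "0 < c2 + c3 + c4"
    and more: "energy \<Gamma>2 TBP < energy \<Gamma>2 X" "energy \<Gamma>3 TBP < energy \<Gamma>3 X"
      "energy \<Gamma>4 TBP < energy \<Gamma>4 X"
  shows "energy f TBP < energy f X"
proof -
  define g where "g = (\<lambda>r. c0 + c1 * G 1 r + c2 * \<Gamma>2 r + c3 * \<Gamma>3 r + c4 * \<Gamma>4 r)"
  have E: "energy g Y = 10 * c0 + c1 * energy (G 1) Y + c2 * energy \<Gamma>2 Y + c3 * energy \<Gamma>3 Y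
      + c4 * energy \<Gamma>4 Y" if "config5 Y" for Y
    unfolding g_def by (simp add: energy_linear energy_const[OF that])
  have "energy f TBP = energy g TBP"
    using touch by (simp add: energy_TBP g_def)
  also have "\<dots> < energy g X"
  proof -
    have "energy (G 1) TBP \<le> energy (G 1) X"
      using energy_G1_ge[OF X] by (simp add: energy_TBP G_def)
    then have "c1 * energy (G 1) TBP \<le> c1 * energy (G 1) X" by (rule mult_left_mono) (rule c)
    moreover have le: "c * energy \<Gamma> TBP \<le> c * energy \<Gamma> X" "0 < c \<Longrightarrow> c * energy \<Gamma> TBP < c * energy \<Gamma> X"
      if "0 \<le> c" "energy \<Gamma> TBP < energy \<Gamma> X" for c \<Gamma>
      using that by (auto intro: mult_left_mono)
    moreover have "0 < c2 \<or> 0 < c3 \<or> 0 < c4" using c by linarith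
    ultimately show ?thesis
      unfolding E[OF X] E[OF config5_TBP]
      using le[OF c(2) more(1)] le[OF c(3) more(2)] le[OF c(4) more(3)] by linarith
  qed
  also have "\<dots> \<le> energy f X"
    using below by (intro energy_mono[OF X]) (simp add: g_def)
  finally show ?thesis .
qed

section \<open>The three interpolation schemes\<close>

text \<open>
  For exponents \<open>1, 2, p, q\<close> the four quadruples are the rows of the inverse of the matrix with the
  rows \<open>(1, 1, 1, 1)\<close>, \<open>(1, 2, p, q)\<close>, \<open>(2, 2\<^sup>2, 2\<^sup>p, 2\<^sup>q)\<close>,
  \<open>(1, 2 * 2, p * 2\<^bsup>p - 1\<^esup>, q * 2\<^bsup>q - 1\<^esup>)\<close>, the data at the nodes of the four powers.
\<close>
definition coeff46_1 :: functional where "coeff46_1 = (16/11, - 24/11, 1, - 3/11)"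
definition coeff46_2 :: functional where "coeff46_2 = (- 4/33, 94/33, - 19/12, 29/66)"
definition coeff46_4 :: functional where "coeff46_4 = (- 13/33, - 49/66, 2/3, - 13/66)"
definition coeff46_6 :: functional where "coeff46_6 = (2/33, 5/66, - 1/12, 1/33)"

definition coeff510_1 :: functional where "coeff510_1 = (20960/11189, - 16432/11189, 55/167, - 709/11189)"
definition coeff510_2 :: functional where "coeff510_2 = (- 9280/11189, 18208/11189, - 295/668, 1909/22378)"
definition coeff510_5 :: functional where "coeff510_5 = (- 502/11189, - 1793/11189, 19/167, - 251/11189)"
definition coeff510_10 :: functional where "coeff510_10 = (11/11189, 17/11189, - 1/668, 11/22378)"

definition coeff35_1 :: functional where "coeff35_1 = (2/3, - 10/3, 13/6, - 2/3)"
definition coeff35_2 :: functional where "coeff35_2 = (2, 6, - 19/4, 3/2)"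
definition coeff35_3 :: functional where "coeff35_3 = (- 11/6, - 17/6, 67/24, - 11/12)"
definition coeff35_5 :: functional where "coeff35_5 = (1/6, 1/6, - 5/24, 1/12)"

lemmas coeff46_defs = coeff46_1_def coeff46_2_def coeff46_4_def coeff46_6_def
lemmas coeff510_defs = coeff510_1_def coeff510_2_def coeff510_5_def coeff510_10_def
lemmas coeff35_defs = coeff35_1_def coeff35_2_def coeff35_3_def coeff35_5_def

definition scheme46 where "scheme46 = [(1, coeff46_1), (2, coeff46_2), (4, coeff46_4), (6, coeff46_6)]"
definition scheme510 where "scheme510 = [(1, coeff510_1), (2, coeff510_2), (5, coeff510_5), (10,
    coeff510_10)]"
definition scheme35 where "scheme35 = [(1, coeff35_1), (2, coeff35_2), (3, coeff35_3), (5, coeff35_5)]"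

section \<open>Values of exponential sums at explicit points\<close>

text \<open>
  The exponential sums that occur as coefficients: \<open>A = 4/3\<close> and \<open>B = 2\<close>.
\<close>
abbreviation kexp :: "real \<Rightarrow> real \<Rightarrow> real \<Rightarrow> real \<Rightarrow> real \<Rightarrow> real \<Rightarrow> real"
  where "kexp \<equiv> exp_sum (ln (4 / 3)) (ln 2)"

lemma exp_ln_mult_numeral:
  fixes x :: real
  assumes "0 < x"
  shows "exp (ln x * numeral n) = x ^ numeral n" "exp (- (ln x * numeral n)) = inverse (x ^ numeral n)"
proof -
  show "exp (ln x * numeral n) = x ^ numeral n"
    using exp_of_nat_mult[of "numeral n" "ln x"] assms by (simp add: mult.commute)
  then show "exp (- (ln x * numeral n)) = inverse (x ^ numeral n)"
    by (simp add: exp_minus)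
qed

lemma kexp_at_integer:
  "kexp c p0 p1 q0 q1 0 = c + p0 + q0"
  "kexp c p0 p1 q0 q1 1 = c + (p0 + p1) * (4 / 3) + (q0 + q1) * 2"
  "kexp c p0 p1 q0 q1 (- 1) = c + (p0 - p1) * (3 / 4) + (q0 - q1) / 2"
  "kexp c p0 p1 q0 q1 (numeral n) =
    c + (p0 + p1 * numeral n) * (4 / 3) ^ numeral n + (q0 + q1 * numeral n) * 2 ^ numeral n"
  "kexp c p0 p1 q0 q1 (- numeral n) =
    c + (p0 - p1 * numeral n) * (3 / 4) ^ numeral n + (q0 - q1 * numeral n) * (1 / 2) ^ numeral n"
  by (simp_all add: exp_sum_def exp_ln_mult_numeral exp_minus power_divide)

lemma exp_ln_mult_bounds:
  fixes x lo hi :: real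
  assumes "0 < x" "0 < n" "0 \<le> hi" "lo ^ n \<le> x ^ m" "x ^ m \<le> hi ^ n"
  shows "lo \<le> exp (ln x * (real m / real n))" "exp (ln x * (real m / real n)) \<le> hi"
proof -
  have "exp (ln x * (real m / real n)) ^ n = exp (real m * ln x)"
    using assms(2) by (simp flip: exp_of_nat_mult)
  then have eq: "exp (ln x * (real m / real n)) ^ n = x ^ m"
    using assms(1) by (simp add: exp_of_nat_mult)
  show "lo \<le> exp (ln x * (real m / real n))"
    using power_le_imp_le_base[of lo "n - 1"] eq assms(2,4) by simp
  show "exp (ln x * (real m / real n)) \<le> hi"
    using power_le_imp_le_base[of _ "n - 1" hi] eq assms(2,3,5) by simp
qed

lemma kexp_at_fraction:
  "kexp c p0 p1 q0 q1 t = c + (p0 + p1 * t) * exp (ln (4 / 3) * t) + (q0 + q1 * t) * exp (ln 2 * t)"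
  by (simp add: exp_sum_def)

text \<open>
  The argument \<open>13/2\<close> is the value of \<open>s/2\<close> at which the second part of the theorem meets the third.
\<close>
lemma exp_bounds_13_2:
  "6.487864 \<le> exp (ln (4 / 3) * (13 / 2) :: real)" "exp (ln (4 / 3) * (13 / 2) :: real) \<le> 6.487865"
  "90.509667 \<le> exp (ln 2 * (13 / 2) :: real)" "exp (ln 2 * (13 / 2) :: real) \<le> 90.509668"
  using exp_ln_mult_bounds[of "4 / 3" 2 "6.487865" "6.487864" 13]
    exp_ln_mult_bounds[of 2 2 "90.509668" "90.509667" 13] by (simp_all add: power_divide)

lemma exp_half_bounds:
  fixes t lo hi lo' hi' :: real
  assumes "lo \<le> exp t" "exp t \<le> hi" "lo'\<^sup>2 \<le> lo" "hi \<le> hi'\<^sup>2" "0 \<le> hi'"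
  shows "lo' \<le> exp (t / 2)" "exp (t / 2) \<le> hi'"
proof -
  have "exp (t / 2) ^ 2 = exp t" by (simp flip: exp_of_nat_mult)
  then show "lo' \<le> exp (t / 2)" "exp (t / 2) \<le> hi'"
    using assms by (auto intro: power2_le_imp_le)
qed

text \<open>
  The argument \<open>301/40\<close> is half of \<open>15.05\<close>. It is reached as \<open>7 + 21/40\<close>, the last summand by one
  fifth root and three square roots; a direct comparison of \<open>40\<close>th powers needs very large numbers.
\<close>
lemma exp_bounds_301_40:
  "8.712925 \<le> exp (ln (4 / 3) * (301 / 40) :: real)" "exp (ln (4 / 3) * (301 / 40) :: real) \<le> 8.712926"
  "184.183497 \<le> exp (ln 2 * (301 / 40) :: real)" "exp (ln 2 * (301 / 40) :: real) \<le> 184.183499"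
proof -
  have split: "exp (ln x * (301 / 40)) = x ^ 7 * exp (ln x * (21 / 5) / 2 / 2 / 2)" if "0 < x" for x :: real
  proof -
    have "ln x * (301 / 40) = ln x * 7 + ln x * (21 / 5) / 2 / 2 / 2" by simp
    then show ?thesis by (simp only: exp_add exp_ln_mult_numeral(1)[OF that])
  qed
  have bd: "3.347670411 \<le> exp (ln (4 / 3) * (21 / 5) :: real)" "exp (ln (4 / 3) * (21 / 5) :: real) \<le>
      3.347670412"
    using exp_ln_mult_bounds[of "4 / 3" 5 "3.347670412" "3.347670411" 21] by (simp_all add: power_divide)
  have bd: "1.829664015 \<le> exp (ln (4 / 3) * (21 / 5) / 2 :: real)"
      "exp (ln (4 / 3) * (21 / 5) / 2 :: real) \<le> 1.829664017"
    using exp_half_bounds[where lo' = "1.829664015" and hi' = "1.829664017",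
        OF bd] by (simp_all add: power_divide)
  have bd: "1.352650736 \<le> exp (ln (4 / 3) * (21 / 5) / 2 / 2 :: real)"
      "exp (ln (4 / 3) * (21 / 5) / 2 / 2 :: real) \<le> 1.352650738"
    using exp_half_bounds[where lo' = "1.352650736" and hi' = "1.352650738",
        OF bd] by (simp_all add: power_divide)
  have bd: "1.163035139 \<le> exp (ln (4 / 3) * (21 / 5) / 2 / 2 / 2 :: real)"
      "exp (ln (4 / 3) * (21 / 5) / 2 / 2 / 2 :: real) \<le> 1.163035141"
    using exp_half_bounds[where lo' = "1.163035139" and hi' = "1.163035141",
        OF bd] by (simp_all add: power_divide)
  have eq: "exp (ln (4 / 3) * (301 / 40) :: real) = (4 / 3) ^ 7 * exp (ln (4 / 3) * (21 / 5) / 2 / 2 / 2)"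
    by (rule split) simp
  show "8.712925 \<le> exp (ln (4 / 3) * (301 / 40) :: real)" "exp (ln (4 / 3) * (301 / 40) :: real) \<le> 8.712926"
    using bd unfolding eq by (simp_all add: power_divide)
  have bd: "18.379173679 \<le> exp (ln 2 * (21 / 5) :: real)" "exp (ln 2 * (21 / 5) :: real) \<le> 18.379173680"
    using exp_ln_mult_bounds[of "2" 5 "18.379173680" "18.379173679" 21] by (simp_all add: power_divide)
  have bd: "4.287093850 \<le> exp (ln 2 * (21 / 5) / 2 :: real)" "exp (ln 2 * (21 / 5) / 2 :: real) \<le>
      4.287093851"
    using exp_half_bounds[where lo' = "4.287093850" and hi' = "4.287093851",
        OF bd] by (simp_all add: power_divide)
  have bd: "2.070529847 \<le> exp (ln 2 * (21 / 5) / 2 / 2 :: real)"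
      "exp (ln 2 * (21 / 5) / 2 / 2 :: real) \<le> 2.070529848"
    using exp_half_bounds[where lo' = "2.070529847" and hi' = "2.070529848",
        OF bd] by (simp_all add: power_divide)
  have bd: "1.438933579 \<le> exp (ln 2 * (21 / 5) / 2 / 2 / 2 :: real)"
      "exp (ln 2 * (21 / 5) / 2 / 2 / 2 :: real) \<le> 1.438933581"
    using exp_half_bounds[where lo' = "1.438933579" and hi' = "1.438933581",
        OF bd] by (simp_all add: power_divide)
  have eq: "exp (ln 2 * (301 / 40) :: real) = 2 ^ 7 * exp (ln 2 * (21 / 5) / 2 / 2 / 2)"
    by (rule split) simp
  show "184.183497 \<le> exp (ln 2 * (301 / 40) :: real)" "exp (ln 2 * (301 / 40) :: real) \<le> 184.183499"
    using bd unfolding eq by (simp_all add: power_divide)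
qed

lemma exp_bounds_minus_half:
  "0.866025 \<le> exp (ln (4 / 3) * (- (1 / 2)) :: real)" "exp (ln (4 / 3) * (- (1 / 2)) :: real) \<le> 0.866026"
  "0.707106 \<le> exp (ln 2 * (- (1 / 2)) :: real)" "exp (ln 2 * (- (1 / 2)) :: real) \<le> 0.707107"
proof -
  have ln: "ln (3 / 4) = - ln (4 / 3 :: real)" "ln (1 / 2) = - ln (2 :: real)"
    by (simp_all add: ln_div)
  show "0.866025 \<le> exp (ln (4 / 3) * (- (1 / 2)) :: real)" "exp (ln (4 / 3) * (- (1 / 2)) :: real) \<le>
      0.866026"
    "0.707106 \<le> exp (ln 2 * (- (1 / 2)) :: real)" "exp (ln 2 * (- (1 / 2)) :: real) \<le> 0.707107"
    using exp_ln_mult_bounds[of "3 / 4" 2 "0.866026" "0.866025" 1]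
      exp_ln_mult_bounds[of "1 / 2" 2 "0.707107" "0.707106" 1]
    unfolding ln by (simp_all add: power_divide)
qed

lemma kexp_pos:
  assumes "u \<in> I" "is_interval I" "w \<in> I" "0 < kexp c p0 p1 q0 q1 w"
    and "\<exists>z\<in>S1. kexp c p0 p1 q0 q1 z = 0" "\<exists>z\<in>S2. kexp c p0 p1 q0 q1 z = 0"
      "\<exists>z\<in>S3. kexp c p0 p1 q0 q1 z = 0" "\<exists>z\<in>S4. kexp c p0 p1 q0 q1 z = 0"
    and "S1 \<inter> S2 = {}" "S1 \<inter> S3 = {}" "S1 \<inter> S4 = {}" "S2 \<inter> S3 = {}" "S2 \<inter> S4 = {}"
      "S3 \<inter> S4 = {}" "I \<inter> (S1 \<union> S2 \<union> S3 \<union> S4) = {}"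
  shows "0 < kexp c p0 p1 q0 q1 u"
  by (rule exp_sum_pos[where I = I and w = w and ?S1.0 = S1 and ?S2.0 = S2 and ?S3.0 = S3 and ?S4.0 = S4])
    (use assms in auto)

lemma kexp_sign_change:
  assumes "x < y" "kexp c p0 p1 q0 q1 x < 0 \<and> 0 < kexp c p0 p1 q0 q1 y \<or>
    0 < kexp c p0 p1 q0 q1 x \<and> kexp c p0 p1 q0 q1 y < 0"
  shows "\<exists>z\<in>{x<..<y}. kexp c p0 p1 q0 q1 z = 0"
  using assms by (intro exp_sum_sign_change) (auto simp: mult_less_0_iff)

section \<open>Signs of the coefficients of the interpolants\<close>

lemma on_power_nonneg:
  assumes "0 \<le> m1 + m2 * k" "0 \<le> m3 + m4 * k / 2"
  shows "0 \<le> on_power (m1, m2, m3, m4) k"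
proof -
  have "0 \<le> (m1 + m2 * k) + (m3 + m4 * k / 2) * 2 ^ k" using assms by simp
  then show ?thesis by (simp add: on_power_def algebra_simps)
qed

text \<open>
  The visible sign changes of this coefficient do not supply four zeros outside the interval.
  Subtracting a suitable exponential sum with four zeros outside leaves a remainder that again has
  four. The first summand approximates a sum with prescribed zeros, with coefficients rounded to
  short decimals; the rounding is harmless because only the signs at the listed points matter. The
  coefficients of \<open>x\<close> in the other schemes are treated in the same way.
\<close>
lemma coeff46_1_pos:
  assumes "0 < u" "u \<le> 3"
  shows "0 < on_kernel coeff46_1 u"
proof -
  have pos1: "0 < kexp (- (57 / 25)) (21 / 10) (- (12 / 25)) (9 / 50) (- (13 / 1000)) u"
    by (rule kexp_pos[where I = "{0<..3}" and w = "3" and ?S1.0 = "{0}" and ?S2.0 = "{5<..<6}"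
          and ?S3.0 = "{8<..<9}" and ?S4.0 = "{10<..<12}"])
      ((rule kexp_sign_change)?; use assms in \<open>force simp: kexp_at_integer power_divide\<close>)+
  have pos2: "0 < kexp (- (48 / 275)) (- (71 / 110)) (- (68 / 275)) (41 / 50) (- (1357 / 11000)) u"
    by (rule kexp_pos[where I = "{0<..3}" and w = "3" and ?S1.0 = "{-6<..<-4}" and ?S2.0 = "{-2<..<-1}"
          and ?S3.0 = "{0}" and ?S4.0 = "{3<..<4}"])
      ((rule kexp_sign_change)?; use assms in \<open>force simp: kexp_at_integer power_divide\<close>)+
  have "on_kernel coeff46_1 u = kexp (- (57 / 25)) (21 / 10) (- (12 / 25)) (9 / 50) (- (13 / 1000)) u
      + kexp (- (48 / 275)) (- (71 / 110)) (- (68 / 275)) (41 / 50) (- (1357 / 11000)) u"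
    by (simp add: on_kernel_def coeff46_defs coeff510_defs coeff35_defs exp_sum_def field_simps)
  then show ?thesis using pos1 pos2 by simp
qed

text \<open>
  In the Taylor series of the coefficient only the term with \<open>k = 5\<close> is negative, and the one with
  \<open>k = 2\<close> exceeds it.
\<close>
lemma coeff46_2_pos:
  assumes u: "0 < u" "u \<le> 3"
  shows "0 < on_kernel coeff46_2 u"
proof -
  let ?c = "kernel_coeff u"
  have "0 \<le> on_power coeff46_2 k" if "k \<noteq> 5" "k \<noteq> 0" for k
  proof (cases "k < 8")
    case True
    then have "k \<in> {1, 2, 3, 4, 6, 7}" using that by auto
    then show ?thesis by (auto simp: coeff46_2_def on_power_def)
  qed (auto simp: coeff46_2_def intro!: on_power_nonneg)
  then have "0 \<le> ?c k * on_power coeff46_2 k" if "k \<noteq> 5" for k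
    using that kernel_coeff_nonneg[OF u(1), of k] by (cases "k = 0") (simp_all add: kernel_coeff_0)
  then have "(\<Sum>k\<in>{2, 5}. ?c k * on_power coeff46_2 k) \<le> on_kernel coeff46_2 u"
    by (intro sum_le_sums[OF on_kernel_sums]) auto
  moreover have "?c 5 \<le> ?c 2 * (5 * 6 * 7 / (12 * 16 * 20))"
  proof -
    have c: "?c 3 = ?c 2 * (u + 2) / 12" "?c 4 = ?c 3 * (u + 3) / 16" "?c 5 = ?c 4 * (u + 4) / 20"
      using kernel_coeff_Suc[of 2 u] kernel_coeff_Suc[of 3 u] kernel_coeff_Suc[of 4 u] by simp_all
    have "(u + 2) * (u + 3) * (u + 4) \<le> 5 * 6 * 7"
      using u by (intro mult_mono) auto
    then have "?c 2 * ((u + 2) * (u + 3) * (u + 4) / (12 * 16 * 20)) \<le> ?c 2 * (5 * 6 * 7 / (12 * 16 * 20))"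
      using kernel_coeff_nonneg[OF u(1)] by (intro mult_left_mono) auto
    then show ?thesis unfolding c by (simp add: algebra_simps)
  qed
  ultimately show ?thesis
    using kernel_coeff_pos[OF u(1), of 2] by (simp add: coeff46_2_def on_power_def)
qed

lemma coeff46_4_pos:
  assumes "0 < u" "u \<le> 3"
  shows "0 < on_kernel coeff46_4 u"
proof -
  have pos: "0 < kexp (- (3 / 11)) (- (13 / 33)) (- (49 / 198)) (2 / 3) (- (13 / 132)) u"
    by (rule kexp_pos[where I = "{0<..3}" and w = "3" and ?S1.0 = "{-2}" and ?S2.0 = "{-1}"
          and ?S3.0 = "{0}" and ?S4.0 = "{3<..<4}"])
      ((rule kexp_sign_change)?; use assms in \<open>force simp: kexp_at_integer power_divide\<close>)+
  have "on_kernel coeff46_4 u = kexp (- (3 / 11)) (- (13 / 33)) (- (49 / 198)) (2 / 3) (- (13 / 132)) u"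
    by (simp add: on_kernel_def coeff46_defs coeff510_defs coeff35_defs exp_sum_def field_simps)
  then show ?thesis using pos by simp
qed

text \<open>
  Only the term with \<open>k = 3\<close> is negative. The terms with \<open>k = 5\<close> and \<open>k = 6\<close> outweigh it, narrowly
  when \<open>u\<close> is small.
\<close>
lemma coeff46_6_nonneg:
  assumes u: "0 < u"
  shows "0 \<le> on_kernel coeff46_6 u"
proof -
  let ?c = "kernel_coeff u"
  have "0 \<le> on_power coeff46_6 k" if "k \<noteq> 3" "k \<noteq> 0" for k
  proof (cases "k < 6")
    case True
    then have "k \<in> {1, 2, 4, 5}" using that by auto
    then show ?thesis by (auto simp: coeff46_6_def on_power_def)
  qed (auto simp: coeff46_6_def intro!: on_power_nonneg)
  then have "0 \<le> ?c k * on_power coeff46_6 k" if "k \<noteq> 3" for k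
    using that kernel_coeff_nonneg[OF u, of k] by (cases "k = 0") (simp_all add: kernel_coeff_0)
  then have "(\<Sum>k\<in>{3, 5, 6}. ?c k * on_power coeff46_6 k) \<le> on_kernel coeff46_6 u"
    by (intro sum_le_sums[OF on_kernel_sums]) auto
  moreover have "12 / 320 * ?c 3 \<le> ?c 5" "5 / 24 * ?c 5 \<le> ?c 6"
  proof -
    have c: "?c 4 = ?c 3 * (u + 3) / 16" "?c 5 = ?c 4 * (u + 4) / 20" "?c 6 = ?c 5 * (u + 5) / 24"
      using kernel_coeff_Suc[of 3 u] kernel_coeff_Suc[of 4 u] kernel_coeff_Suc[of 5 u] by simp_all
    have "3 * 4 \<le> (u + 3) * (u + 4)" using u by (intro mult_mono) auto
    then have "?c 3 * (3 * 4 / 320) \<le> ?c 3 * ((u + 3) * (u + 4) / 320)"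
      using kernel_coeff_nonneg[OF u] by (intro mult_left_mono) auto
    then show "12 / 320 * ?c 3 \<le> ?c 5" unfolding c by (simp add: algebra_simps)
    have "?c 5 * (5 / 24) \<le> ?c 5 * ((u + 5) / 24)"
      using u kernel_coeff_nonneg[OF u] by (intro mult_left_mono) auto
    then show "5 / 24 * ?c 5 \<le> ?c 6" unfolding c(3) by simp
  qed
  ultimately show ?thesis
    using kernel_coeff_nonneg[OF u, of 3] by (simp add: coeff46_6_def on_power_def)
qed

text \<open>
  In the second part the interpolant is expanded in \<open>G\<^sub>1\<close>, \<open>G\<^sub>2\<close>, \<open>G\<^sub>5\<close> and \<open>G10_sharp2\<close>. With the
  coefficients \<open>a\<^sub>1, a\<^sub>2, a\<^sub>5, a\<^sub>1\<^sub>0\<close> of the powers, the new ones are \<open>a\<^sub>1\<close>, \<open>a\<^sub>2 - 102 a\<^sub>1\<^sub>0\<close>,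
  \<open>a\<^sub>5 - 28 a\<^sub>1\<^sub>0\<close> and \<open>a\<^sub>1\<^sub>0\<close>.
\<close>
lemma coeff510_1_pos:
  assumes "3 \<le> u" "u \<le> 13 / 2"
  shows "0 < on_kernel coeff510_1 u"
proof -
  have at1: "0 < kexp (- (29 / 500)) (- (3 / 25)) (- (63 / 1000)) (9 / 50) (- (21 / 1000)) (13 / 2)"
    using exp_bounds_13_2 by (simp add: kexp_at_fraction)
  have pos1: "0 < kexp (- (29 / 500)) (- (3 / 25)) (- (63 / 1000)) (9 / 50) (- (21 / 1000)) u"
    by (rule kexp_pos[where I = "{3..13 / 2}" and w = "3" and ?S1.0 = "{-6<..<-4}" and ?S2.0 = "{-2<..<-1}"
          and ?S3.0 = "{-1<..<0}" and ?S4.0 = "{13 / 2<..<7}"])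
      ((rule kexp_sign_change)?; use at1 assms in \<open>force simp: kexp_at_integer power_divide\<close>)+
  have at1: "0 < kexp (- (11998019 / 5594500)) (557567 / 279725) (- (14317279 / 33567000)) (1247 /
      8350) (- (119531 / 11189000)) (13 / 2)"
    using exp_bounds_13_2 by (simp add: kexp_at_fraction)
  have pos2: "0 < kexp (- (11998019 / 5594500)) (557567 / 279725) (- (14317279 / 33567000)) (1247 /
      8350) (- (119531 / 11189000)) u"
    by (rule kexp_pos[where I = "{3..13 / 2}" and w = "3" and ?S1.0 = "{0<..<1}" and ?S2.0 = "{13 / 2<..<7}"
          and ?S3.0 = "{7<..<8}" and ?S4.0 = "{10<..<11}"])
      ((rule kexp_sign_change)?; use at1 assms in \<open>force simp: kexp_at_integer power_divide\<close>)+
  have "on_kernel coeff510_1 u = kexp (- (29 / 500)) (- (3 / 25)) (- (63 / 1000)) (9 / 50) (- (21 /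
      1000)) u + kexp (- (11998019 / 5594500)) (557567 / 279725) (- (14317279 / 33567000)) (1247 /
      8350) (- (119531 / 11189000)) u"
    by (simp add: on_kernel_def coeff46_defs coeff510_defs coeff35_defs exp_sum_def field_simps)
  then show ?thesis using pos1 pos2 by simp
qed

lemma coeff510_2_gt:
  assumes "3 \<le> u" "u \<le> 13 / 2"
  shows "102 * on_kernel coeff510_10 u < on_kernel coeff510_2 u"
proof -
  have at1: "0 < kexp (54539 / 44756) (- (10402 / 11189)) (16474 / 33567) (- (193 / 668)) (787 /
      44756) (13 / 2)"
    using exp_bounds_13_2 by (simp add: kexp_at_fraction)
  have pos: "0 < kexp (54539 / 44756) (- (10402 / 11189)) (16474 / 33567) (- (193 / 668)) (787 / 44756) u"
    by (rule kexp_pos[where I = "{3..13 / 2}" and w = "3" and ?S1.0 = "{-1}" and ?S2.0 = "{0}"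
          and ?S3.0 = "{13 / 2<..<7}" and ?S4.0 = "{11<..<16}"])
      ((rule kexp_sign_change)?; use at1 assms in \<open>force simp: kexp_at_integer power_divide\<close>)+
  have "on_kernel coeff510_2 u - 102 * on_kernel coeff510_10 u = kexp (54539 / 44756) (- (10402 /
      11189)) (16474 / 33567) (- (193 / 668)) (787 / 44756) u"
    by (simp add: on_kernel_def coeff46_defs coeff510_defs coeff35_defs exp_sum_def field_simps)
  then show ?thesis using pos by simp
qed

lemma coeff510_5_gt:
  assumes "3 \<le> u" "u \<le> 13 / 2"
  shows "28 * on_kernel coeff510_10 u < on_kernel coeff510_5 u"
proof -
  have at1: "0 < kexp (- (932 / 11189)) (- (810 / 11189)) (- (2269 / 33567)) (26 / 167) (- (405 /
      22378)) (13 / 2)"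
    using exp_bounds_13_2 by (simp add: kexp_at_fraction)
  have pos: "0 < kexp (- (932 / 11189)) (- (810 / 11189)) (- (2269 / 33567)) (26 / 167) (- (405 / 22378)) u"
    by (rule kexp_pos[where I = "{3..13 / 2}" and w = "3" and ?S1.0 = "{-2}" and ?S2.0 = "{-1}"
          and ?S3.0 = "{0}" and ?S4.0 = "{13 / 2<..<7}"])
      ((rule kexp_sign_change)?; use at1 assms in \<open>force simp: kexp_at_integer power_divide\<close>)+
  have "on_kernel coeff510_5 u - 28 * on_kernel coeff510_10 u = kexp (- (932 / 11189)) (- (810 /
      11189)) (- (2269 / 33567)) (26 / 167) (- (405 / 22378)) u"
    by (simp add: on_kernel_def coeff46_defs coeff510_defs coeff35_defs exp_sum_def field_simps)
  then show ?thesis using pos by simp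
qed

lemma coeff510_10_pos:
  assumes "3 \<le> u"
  shows "0 < on_kernel coeff510_10 u"
proof -
  have pos: "0 < kexp (23 / 44756) (11 / 11189) (17 / 33567) (- (1 / 668)) (11 / 44756) u"
    by (rule kexp_pos[where I = "{3..}" and w = "3" and ?S1.0 = "{-2}" and ?S2.0 = "{-1}"
          and ?S3.0 = "{0}" and ?S4.0 = "{1<..<2}"])
      ((rule kexp_sign_change)?; use assms in \<open>force simp: kexp_at_integer power_divide\<close>)+
  have "on_kernel coeff510_10 u = kexp (23 / 44756) (11 / 11189) (17 / 33567) (- (1 / 668)) (11 / 44756) u"
    by (simp add: on_kernel_def coeff46_defs coeff510_defs coeff35_defs exp_sum_def field_simps)
  then show ?thesis using pos by simp
qed

text \<open>
  In the third part the expansion is in \<open>G\<^sub>1\<close>, \<open>G\<^sub>2\<close>, \<open>G5_flat\<close> and \<open>G10_sharp\<close>: replacing \<open>G\<^sub>5\<close> by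
  \<open>G5_flat + 25 G\<^sub>1\<close> moves \<open>25\<close> times the coefficient \<open>a\<^sub>5 - 13 a\<^sub>1\<^sub>0\<close> to \<open>G\<^sub>1\<close>. This coefficient
  and the next two become negative between \<open>301/40\<close> and \<open>8\<close>, the present one just after \<open>301/40\<close>.
\<close>
lemma coeff510_1_sharp_pos:
  assumes "13 / 2 \<le> u" "u \<le> 301 / 40"
  shows "0 < on_kernel coeff510_1 u + 25 * (on_kernel coeff510_5 u - 13 * on_kernel coeff510_10 u)"
proof -
  have at1: "0 < kexp (- (39 / 20)) (93 / 50) (- (341 / 1000)) (911 / 10000) (- (621 / 100000)) (13 / 2)"
    using exp_bounds_13_2 by (simp add: kexp_at_fraction)
  have at2: "0 < kexp (- (39 / 20)) (93 / 50) (- (341 / 1000)) (911 / 10000) (- (621 / 100000)) (301 / 40)"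
    using exp_bounds_301_40 by (simp add: kexp_at_fraction)
  have pos1: "0 < kexp (- (39 / 20)) (93 / 50) (- (341 / 1000)) (911 / 10000) (- (621 / 100000)) u"
    by (rule kexp_pos[where I = "{13 / 2..301 / 40}" and w = "13 / 2" and ?S1.0 = "{-1<..<0}"
        and ?S2.0 = "{301 / 40<..<8}"
          and ?S3.0 = "{9<..<10}" and ?S4.0 = "{10<..<11}"])
      ((rule kexp_sign_change)?; use at1 at2 assms in \<open>force simp: kexp_at_integer power_divide\<close>)+
  have at1: "0 < kexp (- (119851 / 55945)) (- (798827 / 559450)) (- (55335653 / 33567000)) (5960363 /
      1670000) (- (431626631 / 1118900000)) (13 / 2)"
    using exp_bounds_13_2 by (simp add: kexp_at_fraction)
  have at2: "0 < kexp (- (119851 / 55945)) (- (798827 / 559450)) (- (55335653 / 33567000)) (5960363 /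
      1670000) (- (431626631 / 1118900000)) (301 / 40)"
    using exp_bounds_301_40 by (simp add: kexp_at_fraction)
  have pos2: "0 < kexp (- (119851 / 55945)) (- (798827 / 559450)) (- (55335653 / 33567000)) (5960363 /
      1670000) (- (431626631 / 1118900000)) u"
    by (rule kexp_pos[where I = "{13 / 2..301 / 40}" and w = "13 / 2" and ?S1.0 = "{-2<..<-1}"
        and ?S2.0 = "{-1<..<0}"
          and ?S3.0 = "{0<..<1}" and ?S4.0 = "{301 / 40<..<8}"])
      ((rule kexp_sign_change)?; use at1 at2 assms in \<open>force simp: kexp_at_integer power_divide\<close>)+
  have "on_kernel coeff510_1 u + 25 * (on_kernel coeff510_5 u - 13 * on_kernel coeff510_10 u) = kexp
      (- (39 / 20)) (93 / 50) (- (341 / 1000)) (911 / 10000) (- (621 / 100000)) u +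
      kexp (- (119851 / 55945)) (- (798827 / 559450)) (- (55335653 / 33567000)) (5960363 / 1670000)
      (- (431626631 / 1118900000)) u"
    by (simp add: on_kernel_def coeff46_defs coeff510_defs coeff35_defs exp_sum_def field_simps)
  then show ?thesis using pos1 pos2 by simp
qed

lemma coeff510_2_sharp_gt:
  assumes "13 / 2 \<le> u" "u \<le> 301 / 40"
  shows "68 * on_kernel coeff510_10 u < on_kernel coeff510_2 u"
proof -
  have at1: "0 < kexp (55321 / 44756) (- (10028 / 11189)) (5684 / 11189) (- (227 / 668)) (1161 /
      44756) (13 / 2)"
    using exp_bounds_13_2 by (simp add: kexp_at_fraction)
  have at2: "0 < kexp (55321 / 44756) (- (10028 / 11189)) (5684 / 11189) (- (227 / 668)) (1161 /
      44756) (301 / 40)"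
    using exp_bounds_301_40 by (simp add: kexp_at_fraction)
  have pos: "0 < kexp (55321 / 44756) (- (10028 / 11189)) (5684 / 11189) (- (227 / 668)) (1161 / 44756) u"
    by (rule kexp_pos[where I = "{13 / 2..301 / 40}" and w = "13 / 2" and ?S1.0 = "{-1}" and ?S2.0 = "{0}"
          and ?S3.0 = "{301 / 40<..<8}" and ?S4.0 = "{8<..<11}"])
      ((rule kexp_sign_change)?; use at1 at2 assms in \<open>force simp: kexp_at_integer power_divide\<close>)+
  have "on_kernel coeff510_2 u - 68 * on_kernel coeff510_10 u = kexp (55321 / 44756) (- (10028 /
      11189)) (5684 / 11189) (- (227 / 668)) (1161 / 44756) u"
    by (simp add: on_kernel_def coeff46_defs coeff510_defs coeff35_defs exp_sum_def field_simps)
  then show ?thesis using pos by simp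
qed

lemma coeff510_5_sharp_gt:
  assumes "13 / 2 \<le> u" "u \<le> 301 / 40"
  shows "13 * on_kernel coeff510_10 u < on_kernel coeff510_5 u"
proof -
  have at1: "0 < kexp (- (3383 / 44756)) (- (645 / 11189)) (- (2014 / 33567)) (89 / 668) (- (645 /
      44756)) (13 / 2)"
    using exp_bounds_13_2 by (simp add: kexp_at_fraction)
  have at2: "0 < kexp (- (3383 / 44756)) (- (645 / 11189)) (- (2014 / 33567)) (89 / 668) (- (645 /
      44756)) (301 / 40)"
    using exp_bounds_301_40 by (simp add: kexp_at_fraction)
  have pos: "0 < kexp (- (3383 / 44756)) (- (645 / 11189)) (- (2014 / 33567)) (89 / 668) (- (645 /
      44756)) u"
    by (rule kexp_pos[where I = "{13 / 2..301 / 40}" and w = "13 / 2" and ?S1.0 = "{-2}" and ?S2.0 = "{-1}"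
          and ?S3.0 = "{0}" and ?S4.0 = "{301 / 40<..<8}"])
      ((rule kexp_sign_change)?; use at1 at2 assms in \<open>force simp: kexp_at_integer power_divide\<close>)+
  have "on_kernel coeff510_5 u - 13 * on_kernel coeff510_10 u = kexp (- (3383 / 44756)) (- (645 /
      11189)) (- (2014 / 33567)) (89 / 668) (- (645 / 44756)) u"
    by (simp add: on_kernel_def coeff46_defs coeff510_defs coeff35_defs exp_sum_def field_simps)
  then show ?thesis using pos by simp
qed

lemma coeff35_1_neg:
  assumes "-1 < u" "u < 0"
  shows "on_kernel coeff35_1 u < 0"
proof -
  have pos1: "0 < kexp (253 / 100) (- (11 / 5)) (63 / 100) (- (33 / 100)) (13 / 500) u"
    by (rule kexp_pos[where I = "{-1..<0}" and w = "-1" and ?S1.0 = "{0}" and ?S2.0 = "{4<..<5}"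
          and ?S3.0 = "{6<..<8}" and ?S4.0 = "{8<..<10}"])
      ((rule kexp_sign_change)?; use assms in \<open>force simp: kexp_at_integer power_divide\<close>)+
  have pos2: "0 < kexp (91 / 300) (23 / 15) (433 / 900) (- (551 / 300)) (461 / 1500) u"
    by (rule kexp_pos[where I = "{-1..<0}" and w = "-1" and ?S1.0 = "{-6<..<-4}" and ?S2.0 = "{-3<..<-2}"
          and ?S3.0 = "{0}" and ?S4.0 = "{2<..<3}"])
      ((rule kexp_sign_change)?; use assms in \<open>force simp: kexp_at_integer power_divide\<close>)+
  have "- on_kernel coeff35_1 u = kexp (253 / 100) (- (11 / 5)) (63 / 100) (- (33 / 100)) (13 / 500) u
      + kexp (91 / 300) (23 / 15) (433 / 900) (- (551 / 300)) (461 / 1500) u"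
    by (simp add: on_kernel_def coeff46_defs coeff510_defs coeff35_defs exp_sum_def field_simps)
  then show ?thesis using pos1 pos2 by simp
qed

text \<open>
  For \<open>-1 < u < 0\<close> the Taylor coefficients of the kernel are negative, except for the constant one.
  In the resulting series for minus the coefficient only the term with \<open>k = 4\<close> is negative, and the
  one with \<open>k = 2\<close> outweighs it.
\<close>
lemma coeff35_2_nonpos:
  assumes u: "- 1 < u" "u < 0"
  shows "on_kernel coeff35_2 u \<le> 0"
proof -
  let ?d = "\<lambda>k. - kernel_coeff u k"
  have d: "0 \<le> ?d k" for k using kernel_coeff_nonpos[OF u] by simp
  have "0 \<le> on_power coeff35_2 k" if "k \<noteq> 4" "k \<noteq> 0" for k
  proof (cases "k < 7")
    case True
    then have "k \<in> {1, 2, 3, 5, 6}" using that by auto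
    then show ?thesis by (auto simp: coeff35_2_def on_power_def)
  qed (auto simp: coeff35_2_def intro!: on_power_nonneg)
  then have "0 \<le> ?d k * on_power coeff35_2 k" if "k \<noteq> 4" for k
    using that d[of k] by (cases "k = 0") (simp_all only: kernel_coeff_0 mult_nonneg_nonneg minus_zero
        mult_zero_left order_refl not_False_eq_True)
  then have "(\<Sum>k\<in>{2, 4}. ?d k * on_power coeff35_2 k) \<le> - on_kernel coeff35_2 u"
    using sums_minus[OF on_kernel_sums[of u coeff35_2]] by (intro sum_le_sums) auto
  moreover have "?d 3 \<le> 2 / 12 * ?d 2" "?d 4 \<le> 3 / 16 * ?d 3"
  proof -
    have c: "?d 3 = ?d 2 * ((u + 2) / 12)" "?d 4 = ?d 3 * ((u + 3) / 16)"
      using kernel_coeff_Suc[of 2 u] kernel_coeff_Suc[of 3 u] by simp_all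
    have "?d 2 * ((u + 2) / 12) \<le> ?d 2 * (2 / 12)" "?d 3 * ((u + 3) / 16) \<le> ?d 3 * (3 / 16)"
      using u by (intro mult_left_mono d; simp)+
    then show "?d 3 \<le> 2 / 12 * ?d 2" "?d 4 \<le> 3 / 16 * ?d 3" unfolding c by simp_all
  qed
  ultimately show ?thesis using d[of 2] by (simp add: coeff35_2_def on_power_def)
qed

lemma coeff35_3_neg:
  assumes "-1 < u" "u < 0"
  shows "on_kernel coeff35_3 u < 0"
proof -
  have at1: "0 < kexp (23 / 24) (11 / 6) (17 / 18) (- (67 / 24)) (11 / 24) (- (1 / 2))"
    using exp_bounds_minus_half by (simp add: kexp_at_fraction)
  have pos: "0 < kexp (23 / 24) (11 / 6) (17 / 18) (- (67 / 24)) (11 / 24) u"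
    by (rule kexp_pos[where I = "{-1<..<0}" and w = "- (1 / 2)" and ?S1.0 = "{-2}" and ?S2.0 = "{-1}"
          and ?S3.0 = "{0}" and ?S4.0 = "{1<..<2}"])
      ((rule kexp_sign_change)?; use at1 assms in \<open>force simp: kexp_at_integer power_divide\<close>)+
  have "- on_kernel coeff35_3 u = kexp (23 / 24) (11 / 6) (17 / 18) (- (67 / 24)) (11 / 24) u"
    by (simp add: on_kernel_def coeff46_defs coeff510_defs coeff35_defs exp_sum_def field_simps)
  then show ?thesis using pos by simp
qed

lemma coeff35_5_neg:
  assumes u: "- 1 < u" "u < 0"
  shows "on_kernel coeff35_5 u < 0"
proof -
  let ?d = "\<lambda>k. - kernel_coeff u k"
  have d: "0 \<le> ?d k" for k using kernel_coeff_nonpos[OF u] by simp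
  have "0 \<le> on_power coeff35_5 k" if "k \<noteq> 0" for k
  proof (cases "k < 5")
    case True
    then have "k \<in> {1, 2, 3, 4}" using that by auto
    then show ?thesis by (auto simp: coeff35_5_def on_power_def)
  qed (auto simp: coeff35_5_def intro!: on_power_nonneg)
  then have "0 \<le> ?d k * on_power coeff35_5 k" for k
    using d[of k] by (cases "k = 0") (simp_all only: kernel_coeff_0 mult_nonneg_nonneg minus_zero
        mult_zero_left order_refl not_False_eq_True)
  then have "(\<Sum>k\<in>{4}. ?d k * on_power coeff35_5 k) \<le> - on_kernel coeff35_5 u"
    using sums_minus[OF on_kernel_sums[of u coeff35_5]] by (intro sum_le_sums) auto
  then show ?thesis
    using kernel_coeff_neg[OF u, of 4] by (simp add: coeff35_5_def on_power_def)
qed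

section \<open>The interpolants lie below the kernel\<close>

text \<open>
  The errors of powers vanish at the nodes \<open>0, 1, 1, 2, 2\<close>, hence are multiples of this polynomial.
\<close>
definition node_poly :: "real \<Rightarrow> real" where "node_poly x = x * (x - 1)\<^sup>2 * (x - 2)\<^sup>2"

lemma node_poly_pos: "0 < x \<Longrightarrow> x \<noteq> 1 \<Longrightarrow> x \<noteq> 2 \<Longrightarrow> 0 < node_poly x"
  by (simp add: node_poly_def)

lemmas coeff46_simps = power_error_def scheme46_def coeff46_defs on_power_def node_poly_def
lemmas coeff510_simps = power_error_def scheme510_def coeff510_defs on_power_def node_poly_def
lemmas coeff35_simps = power_error_def scheme35_def coeff35_defs on_power_def node_poly_def

text \<open>
  The quotient by \<open>node_poly\<close> has coefficients of one sign, as for any interpolation error of a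
  power by powers at positive nodes (Schur functions). The error for \<open>k = 5\<close> is the only negative
  one.
\<close>
lemma power_error_46:
  "power_error scheme46 1 x = 0" "power_error scheme46 2 x = 0" "power_error scheme46 4 x = 0"
      "power_error scheme46 6 x = 0"
  "66 * power_error scheme46 3 x = node_poly x * (6 + x)"
  "66 * power_error scheme46 5 x = - node_poly x * (12 + 13 * x)"
  "2 * power_error scheme46 7 x = node_poly x * (4 + 5 * x + 2 * x\<^sup>2)"
  by (simp_all add: coeff46_simps field_simps power2_eq_square) algebra+

lemma power_error_35:
  "power_error scheme35 1 x = 0" "power_error scheme35 2 x = 0" "power_error scheme35 3 x = 0"
      "power_error scheme35 5 x = 0"
  "6 * power_error scheme35 4 x = - node_poly x"
  "6 * power_error scheme35 6 x = node_poly x * (13 + 6 * x)"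
  "power_error scheme35 7 x = node_poly x * (11 + 6 * x + x ^ 2)"
  "2 * power_error scheme35 8 x = node_poly x * (77 + 46 * x + 12 * x ^ 2 + 2 * x ^ 3)"
  "power_error scheme35 9 x = node_poly x * (114 + 72 * x + 23 * x ^ 2 + 6 * x ^ 3 + x ^ 4)"
  "6 * power_error scheme35 10 x = node_poly x * (1841 + 1206 * x + 432 * x ^ 2 + 138 * x ^ 3 +
      36 * x ^ 4 + 6 * x ^ 5)"
  "power_error scheme35 11 x = node_poly x * (777 + 522 * x + 201 * x ^ 2 + 72 * x ^ 3 + 23 * x ^ 4 +
      6 * x ^ 5 + x ^ 6)"
  by (simp_all add: coeff35_simps field_simps power2_eq_square) algebra+

text \<open>
  The polynomial whose coefficients have the partial sums \<open>s0, \<dots>, s5\<close>, in the form of Abel summation.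
  For \<open>0 \<le> t \<le> 1\<close> all six weights are nonnegative, so nonnegative partial sums suffice for a
  nonnegative value, even if some coefficients are negative.
\<close>
definition abel_sum :: "real \<Rightarrow> real \<Rightarrow> real \<Rightarrow> real \<Rightarrow> real \<Rightarrow> real \<Rightarrow> real \<Rightarrow> real" where
  "abel_sum s0 s1 s2 s3 s4 s5 t = s0 * (1 - t) + s1 * (t - t ^ 2) + s2 * (t ^ 2 - t ^ 3) +
     s3 * (t ^ 3 - t ^ 4) + s4 * (t ^ 4 - t ^ 5) + s5 * t ^ 5"

text \<open>
  The number \<open>11189 = 67 * 167\<close> is a common denominator. The errors are negative for
  \<open>k = 6, 7, 8, 9\<close> and positive for \<open>k = 3, 4\<close> and \<open>k \<ge> 11\<close>. Coefficients of the quotient beyond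
  \<open>t ^ 5\<close> are kept apart: they only occur for \<open>k \<ge> 11\<close>, where they are positive and can be dropped.
\<close>
lemma power_error_510:
  "power_error scheme510 1 x = 0" "power_error scheme510 2 x = 0" "power_error scheme510 5 x = 0"
      "power_error scheme510 10 x = 0"
  "11189 * power_error scheme510 3 (4 * t) = node_poly (4 * t) *
     (abel_sum 1841 6665 13577 22409 31625 37769 t)"
  "11189 * power_error scheme510 4 (4 * t) = node_poly (4 * t) *
     (abel_sum 2124 12576 27552 46688 66656 79968 t)"
  "11189 * power_error scheme510 6 (4 * t) = node_poly (4 * t) *
     (abel_sum (- 5520) (- 38752) (- 150496) (- 293280) (- 442272) (- 541600) t)"
  "11189 * power_error scheme510 7 (4 * t) = node_poly (4 * t) *
     (abel_sum (- 14996) (- 108260) (- 447636) (- 1110036) (- 1801236) (- 2262036) t)"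
  "11189 * power_error scheme510 8 (4 * t) = node_poly (4 * t) *
     (abel_sum (- 26712) (- 196088) (- 839576) (- 2318232) (- 4608408) (- 6135192) t)"
  "11189 * power_error scheme510 9 (4 * t) = node_poly (4 * t) *
     (abel_sum (- 31564) (- 234172) (- 1024140) (- 2998284) (- 6677260) (- 11039500) t)"
  "11189 * power_error scheme510 11 (4 * t) = node_poly (4 * t) *
     (abel_sum 149772 1124220 5029452 15599052 38708428 78939340 t + t ^ 6 * (45830144))"
  "11189 * power_error scheme510 12 (4 * t) = node_poly (4 * t) *
     (abel_sum 626712 4719608 21245336 66887832 170557080 365702808 t + t ^ 6 * (274980864 +
         183320576 * t))"
  "11189 * power_error scheme510 13 (4 * t) = node_poly (4 * t) *
     (abel_sum 1939492 14639476 66185700 210532452 546841956 1212163428 t + t ^ 6 * (1054093312 +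
         1099923456 * t + 733282304 * t ^ 2))"
  "11189 * power_error scheme510 14 (4 * t) = node_poly (4 * t) *
     (abel_sum 5286960 39972592 181278256 580841520 1528310832 3466116144 t + t ^ 6 * (3299770368 +
         4216373248 * t + 4399693824 * t ^ 2 + 2933129216 * t ^ 3))"
  "11189 * power_error scheme510 15 (4 * t) = node_poly (4 * t) *
     (abel_sum 13429820 101660780 462081660 1488385020 3952770812 9111248636 t + t ^ 6 * (9211858944 +
         13199081472 * t + 16865492992 * t ^ 2 + 17598775296 * t ^ 3 + 11732516864 * t ^ 4))"
  "11189 * power_error scheme510 16 (4 * t) = node_poly (4 * t) *
     (abel_sum 32615496 247116264 1125119688 3638208456 9728459208 22691131848 t +
         t ^ 6 * (23923335168 + 36847435776 * t + 52796325888 * t ^ 2 + 67461971968 * t ^ 3 +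
         70395101184 * t ^ 4 + 46930067456 * t ^ 5))"
  "11189 * power_error scheme510 17 (4 * t) = node_poly (4 * t) *
     (abel_sum 76790868 582220644 2654252820 8608213908 23137096852 54445298836 t +
         t ^ 6 * (59166715904 + 95693340672 * t + 147389743104 * t ^ 2 + 211185303552 * t ^ 3 +
         269847887872 * t ^ 4 + 281580404736 * t ^ 5 + 187720269824 * t ^ 6))"
  "11189 * power_error scheme510 18 (4 * t) = node_poly (4 * t) *
     (abel_sum 176753760 1340851424 6118827872 19889827680 53672617824 127157598048 t +
         t ^ 6 * (141340164096 + 236666863616 * t + 382773362688 * t ^ 2 + 589558972416 * t ^ 3 +
         844741214208 * t ^ 4 + 1079391551488 * t ^ 5 + 1126321618944 * t ^ 6 + 750881079296 * t ^ 7))"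
  "11189 * power_error scheme510 19 (4 * t) = node_poly (4 * t) *
     (abel_sum 399907948 3034992220 13860790188 45137146668 122183875116 291005291052 t +
         t ^ 6 * (329106264064 + 565360656384 * t + 946667454464 * t ^ 2 + 1531093450752 * t ^ 3 +
         2358235889664 * t ^ 4 + 3378964856832 * t ^ 5 + 4317566205952 * t ^ 6 +
         4505286475776 * t ^ 7 + 3003524317184 * t ^ 8))"
  "11189 * power_error scheme510 20 (4 * t) = node_poly (4 * t) *
     (abel_sum 892677240 6777067480 30970533880 101000853240 274090544376 655562030328 t +
         t ^ 6 * (751522701312 + 1316425056256 * t + 2261442625536 * t ^ 2 + 3786669817856 * t ^ 3 +
         6124373803008 * t ^ 4 + 9432943558656 * t ^ 5 + 13515859427328 * t ^ 6 +
         17270264823808 * t ^ 7 + 18021145903104 * t ^ 8 + 12014097268736 * t ^ 9))"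
  by (simp_all add: coeff510_simps abel_sum_def field_simps power2_eq_square) algebra+

fun weighted_sum :: "real \<Rightarrow> nat \<Rightarrow> real list \<Rightarrow> real" where
  "weighted_sum u k [] = 0"
| "weighted_sum u k (s # ss) = kernel_coeff u k * s + weighted_sum u (Suc k) ss"

text \<open>
  Horner's scheme for \<open>\<Sum>i. ss ! i * (kernel_coeff (v + 3) (k + i) / kernel_coeff (v + 3) k)\<close> as a
  polynomial in \<open>v\<close>, by the recursion for the Taylor coefficients.
\<close>
fun ratio_poly :: "nat \<Rightarrow> real list \<Rightarrow> real poly" where
  "ratio_poly k [] = 0"
| "ratio_poly k (s # ss) = [:s:] + smult (1 / (4 * (real k + 1))) ([:real k + 3,
    1:] * ratio_poly (Suc k) ss)"

lemma weighted_sum_eq_poly: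
  assumes "1 \<le> k"
  shows "weighted_sum (v + 3) k ss = kernel_coeff (v + 3) k * poly (ratio_poly k ss) v"
  using assms
proof (induction ss arbitrary: k)
  case (Cons s ss)
  then show ?case by (simp add: kernel_coeff_Suc algebra_simps add_divide_distrib)
qed simp

text \<open>
  The inequality \<open>v * (v - m)\<^sup>2 \<ge> 0\<close> replaces the cubic term by a quadratic one, and a quadratic
  with nonpositive discriminant is left.
\<close>
lemma poly_nonneg_by_cubic:
  fixes v :: real
  assumes "\<alpha> \<le> a" "\<beta> \<le> b" "\<gamma> \<le> c" "\<delta> \<le> d"
    and v: "0 \<le> v" "0 \<le> poly r v" "0 \<le> \<delta>"
    and disc: "(\<beta> - \<delta> * m\<^sup>2)\<^sup>2 \<le> 4 * \<alpha> * (\<gamma> + 2 * \<delta> * m)" and pos: "0 < \<gamma> + 2 * \<delta> * m"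
  shows "0 \<le> poly (pCons a (pCons b (pCons c (pCons d r)))) v"
proof -
  define B C where "B = \<beta> - \<delta> * m\<^sup>2" and "C = \<gamma> + 2 * \<delta> * m"
  have "4 * C * (\<alpha> + B * v + C * v\<^sup>2) = (2 * C * v + B)\<^sup>2 + (4 * \<alpha> * C - B\<^sup>2)"
    by (simp add: power2_eq_square algebra_simps)
  also have "0 \<le> \<dots>" using disc by (intro add_nonneg_nonneg) (simp_all add: B_def C_def)
  finally have "0 \<le> \<alpha> + B * v + C * v\<^sup>2" using pos by (simp add: C_def zero_le_mult_iff)
  moreover have "0 \<le> \<delta> * (v * (v - m)\<^sup>2)" "0 \<le> v ^ 4 * poly r v"
    using v by simp_all
  moreover have "0 \<le> (a - \<alpha>) + (b - \<beta>) * v + (c - \<gamma>) * v ^ 2 + (d - \<delta>) * v ^ 3"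
    using assms by (intro add_nonneg_nonneg mult_nonneg_nonneg) simp_all
  ultimately have "0 \<le> ((a - \<alpha>) + (b - \<beta>) * v + (c - \<gamma>) * v ^ 2 + (d - \<delta>) * v ^ 3) +
      (\<alpha> + B * v + C * v\<^sup>2) + \<delta> * (v * (v - m)\<^sup>2) + v ^ 4 * poly r v"
    by linarith
  also have "\<dots> = poly (pCons a (pCons b (pCons c (pCons d r)))) v"
    by (simp add: B_def C_def power2_eq_square power3_eq_cube power4_eq_xxxx algebra_simps)
  finally show ?thesis .
qed

lemma poly_pCons_nonneg:
  fixes v :: real
  shows "0 \<le> v \<Longrightarrow> 0 \<le> a \<Longrightarrow> 0 \<le> poly p v \<Longrightarrow> 0 \<le> poly (pCons a p) v"
  by simp

text \<open>
  The lists in this lemma and in the next five contain the six columns of partial sums from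
  \<open>power_error_510\<close> for \<open>k = 3, \<dots>, 20\<close>, with zeros at \<open>k = 5\<close> and \<open>k = 10\<close>, where the errors vanish.
  As polynomials in \<open>v = u - 3\<close> the sums have nonnegative coefficients from \<open>v ^ 3\<close> on; the first
  four coefficients are rounded down. The cut at \<open>k = 20\<close> leaves enough positive terms for \<open>u\<close> near
  \<open>4\<close> and \<open>5\<close>, where the margin is smallest.
\<close>
lemma weighted_sum_nonneg_0:
  assumes "0 \<le> v"
  shows "0 \<le> weighted_sum (v + 3) 3
    [1841, 2124, 0, - 5520, - 14996, - 26712, - 31564, 0, 149772, 626712, 1939492, 5286960, 13429820,
        32615496, 76790868, 176753760, 399907948, 892677240]"
    (is "0 \<le> weighted_sum _ _ ?ss")
proof -
  have "0 \<le> poly (ratio_poly 3 ?ss) v"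
    by (simp del: poly_pCons) (rule poly_nonneg_by_cubic[where \<alpha> = "2100" and \<beta> = "-85"
        and \<gamma> = "-15" and \<delta> = "8" and m = "2"];
      (intro poly_pCons_nonneg assms)?; simp add: power2_eq_square)
  moreover have "0 \<le> kernel_coeff (v + 3) 3" using assms by (intro kernel_coeff_nonneg) simp
  moreover have "(1 :: nat) \<le> 3" by simp
  ultimately show ?thesis
    by (simp only: weighted_sum_eq_poly mult_nonneg_nonneg)
qed

lemma weighted_sum_nonneg_1:
  assumes "0 \<le> v"
  shows "0 \<le> weighted_sum (v + 3) 3
    [6665, 12576, 0, - 38752, - 108260, - 196088, - 234172, 0, 1124220, 4719608, 14639476, 39972592,
        101660780, 247116264, 582220644, 1340851424, 3034992220, 6777067480]"
    (is "0 \<le> weighted_sum _ _ ?ss")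
proof -
  have "0 \<le> poly (ratio_poly 3 ?ss) v"
    by (simp del: poly_pCons) (rule poly_nonneg_by_cubic[where \<alpha> = "7700" and \<beta> = "-740"
        and \<gamma> = "-87" and \<delta> = "67" and m = "2"];
      (intro poly_pCons_nonneg assms)?; simp add: power2_eq_square)
  moreover have "0 \<le> kernel_coeff (v + 3) 3" using assms by (intro kernel_coeff_nonneg) simp
  moreover have "(1 :: nat) \<le> 3" by simp
  ultimately show ?thesis
    by (simp only: weighted_sum_eq_poly mult_nonneg_nonneg)
qed

lemma weighted_sum_nonneg_2:
  assumes "0 \<le> v"
  shows "0 \<le> weighted_sum (v + 3) 3
    [13577, 27552, 0, - 150496, - 447636, - 839576, - 1024140, 0, 5029452, 21245336, 66185700,
        181278256, 462081660, 1125119688, 2654252820, 6118827872, 13860790188, 30970533880]"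
    (is "0 \<le> weighted_sum _ _ ?ss")
proof -
  have "0 \<le> poly (ratio_poly 3 ?ss) v"
    by (simp del: poly_pCons) (rule poly_nonneg_by_cubic[where \<alpha> = "9500" and \<beta> = "-4212"
        and \<gamma> = "-211" and \<delta> = "322" and m = "2"];
      (intro poly_pCons_nonneg assms)?; simp add: power2_eq_square)
  moreover have "0 \<le> kernel_coeff (v + 3) 3" using assms by (intro kernel_coeff_nonneg) simp
  moreover have "(1 :: nat) \<le> 3" by simp
  ultimately show ?thesis
    by (simp only: weighted_sum_eq_poly mult_nonneg_nonneg)
qed

lemma weighted_sum_nonneg_3:
  assumes "0 \<le> v"
  shows "0 \<le> weighted_sum (v + 3) 3
    [22409, 46688, 0, - 293280, - 1110036, - 2318232, - 2998284, 0, 15599052, 66887832, 210532452,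
        580841520, 1488385020, 3638208456, 8608213908, 19889827680, 45137146668, 101000853240]"
    (is "0 \<le> weighted_sum _ _ ?ss")
proof -
  have "0 \<le> poly (ratio_poly 3 ?ss) v"
    by (simp del: poly_pCons) (rule poly_nonneg_by_cubic[where \<alpha> = "8500" and \<beta> = "-8752"
        and \<gamma> = "679" and \<delta> = "1149" and m = "7 / 5"];
      (intro poly_pCons_nonneg assms)?; simp add: power2_eq_square)
  moreover have "0 \<le> kernel_coeff (v + 3) 3" using assms by (intro kernel_coeff_nonneg) simp
  moreover have "(1 :: nat) \<le> 3" by simp
  ultimately show ?thesis
    by (simp only: weighted_sum_eq_poly mult_nonneg_nonneg)
qed

lemma weighted_sum_nonneg_4:
  assumes "0 \<le> v"
  shows "0 \<le> weighted_sum (v + 3) 3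
    [31625, 66656, 0, - 442272, - 1801236, - 4608408, - 6677260, 0, 38708428, 170557080, 546841956,
        1528310832, 3952770812, 9728459208, 23137096852, 53672617824, 122183875116, 274090544376]"
    (is "0 \<le> weighted_sum _ _ ?ss")
proof -
  have "0 \<le> poly (ratio_poly 3 ?ss) v"
    by (simp del: poly_pCons) (rule poly_nonneg_by_cubic[where \<alpha> = "11900" and \<beta> = "-6576"
        and \<gamma> = "5780" and \<delta> = "0" and m = "0"];
      (intro poly_pCons_nonneg assms)?; simp add: power2_eq_square)
  moreover have "0 \<le> kernel_coeff (v + 3) 3" using assms by (intro kernel_coeff_nonneg) simp
  moreover have "(1 :: nat) \<le> 3" by simp
  ultimately show ?thesis
    by (simp only: weighted_sum_eq_poly mult_nonneg_nonneg)
qed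

lemma weighted_sum_nonneg_5:
  assumes "0 \<le> v"
  shows "0 \<le> weighted_sum (v + 3) 3
    [37769, 79968, 0, - 541600, - 2262036, - 6135192, - 11039500, 0, 78939340, 365702808, 1212163428,
        3466116144, 9111248636, 22691131848, 54445298836, 127157598048, 291005291052, 655562030328]"
    (is "0 \<le> weighted_sum _ _ ?ss")
proof -
  have "0 \<le> poly (ratio_poly 3 ?ss) v"
    by (simp del: poly_pCons) (rule poly_nonneg_by_cubic[where \<alpha> = "35000" and \<beta> = "0"
        and \<gamma> = "1" and \<delta> = "0" and m = "0"];
      (intro poly_pCons_nonneg assms)?; simp add: power2_eq_square)
  moreover have "0 \<le> kernel_coeff (v + 3) 3" using assms by (intro kernel_coeff_nonneg) simp
  moreover have "(1 :: nat) \<le> 3" by simp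
  ultimately show ?thesis
    by (simp only: weighted_sum_eq_poly mult_nonneg_nonneg)
qed

lemma kernel_error_touch:
  assumes "x \<in> {0, 1, 2}" "\<And>k. 0 < k \<Longrightarrow> power_error L k x = 0"
  shows "kernel_error L u x = 0"
proof -
  have "(\<lambda>k. kernel_coeff u k * power_error L k x) = (\<lambda>k. 0)"
  proof
    show "kernel_coeff u k * power_error L k x = 0" for k
      using assms(2)[of k] by (cases "k = 0") (simp_all add: kernel_coeff_def)
  qed
  then have "(\<lambda>k. 0) sums kernel_error L u x"
    using kernel_error_sums[of x u L] assms(1) by auto
  then show ?thesis using sums_unique2 sums_zero by blast
qed

lemma scheme46_touch: "x \<in> {0, 1, 2} \<Longrightarrow> 0 < k \<Longrightarrow> power_error scheme46 k x = 0"
  and scheme510_touch: "x \<in> {0, 1, 2} \<Longrightarrow> 0 < k \<Longrightarrow> power_error scheme510 k x = 0"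
  and scheme35_touch: "x \<in> {0, 1, 2} \<Longrightarrow> 0 < k \<Longrightarrow> power_error scheme35 k x = 0"
  by (auto simp: coeff46_simps coeff510_simps coeff35_simps field_simps)

text \<open>
  Of the series only the terms with \<open>k = 3, 5, 7\<close> are needed, the middle one being negative. Their
  sum, divided by \<open>kernel_coeff u 3 * node_poly x\<close>, is a quadratic polynomial in \<open>x\<close> with
  nonnegative coefficients.
\<close>
lemma kernel_error_46_nonneg:
  assumes u: "0 < u" and x: "0 \<le> x" "x < 4"
  shows "0 \<le> kernel_error scheme46 u x"
proof (cases "x \<in> {0, 1, 2}")
  case True
  then show ?thesis using kernel_error_touch[OF True scheme46_touch[OF True]] by simp
next
  case False
  let ?c = "kernel_coeff u" and ?e = "\<lambda>k. power_error scheme46 k x"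
  have pos: "0 < node_poly x" using False x by (intro node_poly_pos) auto
  have e7: "0 < ?e 7"
    using power_error_46(7)[of x] pos x by (smt (verit) mult_pos_pos zero_le_power2)
  have nonneg: "0 \<le> ?c k * ?e k" if "k \<notin> {3, 5}" for k
  proof (cases "k < 7")
    case True
    then have "k \<in> {0, 1, 2, 3, 4, 5, 6}" by auto
    then show ?thesis using that power_error_46 by (auto simp: kernel_coeff_def)
  next
    case ge: False
    have "0 \<le> ?e k"
      using False x ge power_error_46
      by (intro power_error_nonneg[where N = "{1, 2, 4, 6}" and r = 7, OF _ _ _ _ _ _ e7]) auto
    then show ?thesis using kernel_coeff_nonneg[OF u] by simp
  qed
  have "(\<Sum>k\<in>{3, 5, 7}. ?c k * ?e k) \<le> kernel_error scheme46 u x"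
    by (intro sum_le_sums[OF kernel_error_sums[OF x]] nonneg) auto
  moreover have "0 \<le> (\<Sum>k\<in>{3, 5, 7}. ?c k * ?e k)"
  proof -
    define s where "s = (u + 3) * (u + 4) / 320"
    define p where "p = (u + 5) * (u + 6) / 672"
    have c: "?c 4 = ?c 3 * (u + 3) / 16" "?c 5 = ?c 4 * (u + 4) / 20" "?c 6 = ?c 5 * (u + 5) / 24"
      "?c 7 = ?c 6 * (u + 6) / 28"
      using kernel_coeff_Suc[of 3 u] kernel_coeff_Suc[of 4 u] kernel_coeff_Suc[of 5 u]
        kernel_coeff_Suc[of 6 u] by simp_all
    have c5: "?c 5 = ?c 3 * s" and c7: "?c 7 = ?c 3 * s * p"
      unfolding c s_def p_def by simp_all
    have e: "?e 3 = node_poly x * (6 + x) / 66" "?e 5 = - node_poly x * (12 + 13 * x) / 66"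
      "?e 7 = node_poly x * (4 + 5 * x + 2 * x\<^sup>2) / 2"
      using power_error_46(5-7)[of x] by simp_all
    have s: "0 < s" using u by (simp add: s_def)
    have p: "(320 * s + 18) / 672 \<le> p" using u by (simp add: s_def p_def field_simps)
    have 1: "0 \<le> 6 - 12 * s + 132 * (s * p)" "0 \<le> 1 - 13 * s + 165 * (s * p)"
    proof -
      \<comment> \<open>With \<open>p\<close> replaced by its lower bound both expressions are quadratic in \<open>s\<close> with
        negative discriminant; a multiple of \<open>(s - 1/10)\<^sup>2\<close> shows that they are positive.\<close>
      have sp: "s * ((320 * s + 18) / 672) \<le> s * p" using s p by (intro mult_left_mono) auto
      show "0 \<le> 6 - 12 * s + 132 * (s * p)" "0 \<le> 1 - 13 * s + 165 * (s * p)"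
        using sp zero_le_power2[of "s - 1 / 10"] s
        by (simp_all add: power2_eq_square algebra_simps)
    qed
    have eq: "(\<Sum>k\<in>{3, 5, 7}. ?c k * ?e k) = ?c 3 * node_poly x / 66 *
        ((6 - 12 * s + 132 * (s * p)) + (1 - 13 * s + 165 * (s * p)) * x + 66 * (s * p) * x\<^sup>2)"
      by (simp add: c5 c7 e field_simps)
    have "0 \<le> p" using u by (simp add: p_def)
    then have "0 \<le> (6 - 12 * s + 132 * (s * p)) + (1 - 13 * s + 165 * (s * p)) * x + 66 * (s * p) * x\<^sup>2"
      using 1 x s by (intro add_nonneg_nonneg[OF add_nonneg_nonneg] mult_nonneg_nonneg) auto
    then show ?thesis
      unfolding eq using pos kernel_coeff_nonneg[OF u, of 3] by (intro mult_nonneg_nonneg) auto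
  qed
  ultimately show ?thesis by linarith
qed

text \<open>
  The four negative terms \<open>k = 6, \<dots>, 9\<close> are compensated by the positive ones up to \<open>k = 20\<close>. The sum
  of these terms, divided by \<open>node_poly x\<close>, is a polynomial in \<open>t = x / 4\<close>, treated by Abel
  summation.
\<close>
lemma kernel_error_510_nonneg:
  assumes u: "3 \<le> u" and x: "0 \<le> x" "x < 4"
  shows "0 \<le> kernel_error scheme510 u x"
proof (cases "x \<in> {0, 1, 2}")
  case True
  then show ?thesis using kernel_error_touch[OF True scheme510_touch[OF True]] by simp
next
  case False
  let ?c = "kernel_coeff u" and ?e = "\<lambda>k. power_error scheme510 k x"
  define t v where "t = x / 4" and "v = u - 3"
  have t: "x = 4 * t" "0 \<le> t" "t \<le> 1" and v: "u = v + 3" "0 \<le> v"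
    using x u by (simp_all add: t_def v_def)
  have w: "0 \<le> 1 - t" "0 \<le> t - t ^ 2" "0 \<le> t ^ 2 - t ^ 3" "0 \<le> t ^ 3 - t ^ 4" "0 \<le> t ^ 4 - t ^ 5" "0 \<le>
      t ^ 5"
    using t(2,3) power_decreasing[of 1 2 t] power_decreasing[of 2 3 t] power_decreasing[of 3 4 t]
      power_decreasing[of 4 5 t] by simp_all
  have u0: "0 < u" using u by simp
  have pos: "0 < node_poly x" using False x by (intro node_poly_pos) auto
  have c: "0 \<le> ?c k" for k using kernel_coeff_nonneg[OF u0] .
  have e11: "0 < ?e 11"
  proof -
    have "0 < 149772 + (974448 * (t - t ^ 2) + 4879680 * (t ^ 2 - t ^ 3) + 15449280 * (t ^ 3 - t ^ 4) +
        38558656 * (t ^ 4 - t ^ 5) + 78789568 * t ^ 5 + t ^ 6 * 45830144)"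
      using w t(2) by (intro add_pos_nonneg add_nonneg_nonneg mult_nonneg_nonneg) auto
    also have "\<dots> = abel_sum 149772 1124220 5029452 15599052 38708428 78939340 t + t ^ 6 * 45830144"
      by (simp add: abel_sum_def algebra_simps)
    finally have "0 < abel_sum 149772 1124220 5029452 15599052 38708428 78939340 t + t ^ 6 * 45830144" .
    then have "0 < 11189 * ?e 11"
      unfolding power_error_510(11)[of t, folded t(1)] using pos by (intro mult_pos_pos)
    then show ?thesis by simp
  qed
  have nonneg: "0 \<le> ?c k * ?e k" if "k \<notin> {3, 4, 6, 7, 8, 9, 11, 12, 13, 14, 15, 16, 17, 18, 19, 20}" for k
  proof (cases "k < 11")
    case True
    then have "k \<in> {0, 1, 2, 5, 10}" using that by simp presburger
    then show ?thesis using power_error_510 by (auto simp: kernel_coeff_def)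
  next
    case ge: False
    have "0 \<le> ?e k"
      using False x ge power_error_510
      by (intro power_error_nonneg[where N = "{1, 2, 5, 10}" and r = 11, OF _ _ _ _ _ _ e11]) auto
    then show ?thesis using c by simp
  qed
  have "(\<Sum>k\<in>{3, 4, 6, 7, 8, 9, 11, 12, 13, 14, 15, 16, 17, 18, 19, 20}. ?c k * ?e k) \<le>
      kernel_error scheme510 u x"
    by (intro sum_le_sums[OF kernel_error_sums[OF x]] nonneg) auto
  moreover have "0 \<le> (\<Sum>k\<in>{3, 4, 6, 7, 8, 9, 11, 12, 13, 14, 15, 16, 17, 18, 19, 20}. ?c k * ?e k)"
  proof -
    let ?n = "node_poly x"
    define w0 w1 w2 w3 w4 w5 where w_defs: "w0 = 1 - t" "w1 = t - t ^ 2" "w2 = t ^ 2 - t ^ 3"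
        "w3 = t ^ 3 - t ^ 4" "w4 = t ^ 4 - t ^ 5" "w5 = t ^ 5"
    have abel: "abel_sum s0 s1 s2 s3 s4 s5 t = s0 * w0 + s1 * w1 + s2 * w2 + s3 * w3 + s4 * w4 + s5 * w5"
      for s0 s1 s2 s3 s4 s5 by (simp add: abel_sum_def w_defs)
    have drop: "c * (?n * a) \<le> 11189 * (c * e)" if "11189 * e = ?n * (a + r)" "0 \<le> c" "0 \<le> r" for a c e r
    proof -
      have "c * (?n * a) + c * (?n * r) = 11189 * (c * e)"
        using that(1) by (metis distrib_left mult.left_commute)
      moreover have "0 \<le> c * (?n * r)" using that pos by simp
      ultimately show ?thesis by linarith
    qed
    note e = power_error_510[of t, folded t(1)]
    have b3: "?c 3 * (?n * abel_sum 1841 6665 13577 22409 31625 37769 t) \<le> 11189 * (?c 3 * ?e 3)"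
      by (rule drop[where r = 0, OF _ c]) (use e(5) in simp_all)
    have b4: "?c 4 * (?n * abel_sum 2124 12576 27552 46688 66656 79968 t) \<le> 11189 * (?c 4 * ?e 4)"
      by (rule drop[where r = 0, OF _ c]) (use e(6) in simp_all)
    have b6: "?c 6 * (?n * abel_sum (- 5520) (- 38752) (- 150496) (- 293280) (- 442272) (- 541600) t)
        \<le> 11189 * (?c 6 * ?e 6)"
      by (rule drop[where r = 0, OF _ c]) (use e(7) in simp_all)
    have b7: "?c 7 * (?n * abel_sum (- 14996) (- 108260) (- 447636) (- 1110036) (- 1801236)
        (- 2262036) t) \<le> 11189 * (?c 7 * ?e 7)"
      by (rule drop[where r = 0, OF _ c]) (use e(8) in simp_all)
    have b8: "?c 8 * (?n * abel_sum (- 26712) (- 196088) (- 839576) (- 2318232) (- 4608408)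
        (- 6135192) t) \<le> 11189 * (?c 8 * ?e 8)"
      by (rule drop[where r = 0, OF _ c]) (use e(9) in simp_all)
    have b9: "?c 9 * (?n * abel_sum (- 31564) (- 234172) (- 1024140) (- 2998284) (- 6677260)
        (- 11039500) t) \<le> 11189 * (?c 9 * ?e 9)"
      by (rule drop[where r = 0, OF _ c]) (use e(10) in simp_all)
    have b11: "?c 11 * (?n * abel_sum 149772 1124220 5029452 15599052 38708428 78939340 t) \<le>
        11189 * (?c 11 * ?e 11)"
      by (rule drop[OF e(11) c]) (use t in simp)
    have b12: "?c 12 * (?n * abel_sum 626712 4719608 21245336 66887832 170557080 365702808 t) \<le>
        11189 * (?c 12 * ?e 12)"
      by (rule drop[OF e(12) c]) (use t in simp)
    have b13: "?c 13 * (?n * abel_sum 1939492 14639476 66185700 210532452 546841956 1212163428 t) \<le>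
        11189 * (?c 13 * ?e 13)"
      by (rule drop[OF e(13) c]) (use t in simp)
    have b14: "?c 14 * (?n * abel_sum 5286960 39972592 181278256 580841520 1528310832 3466116144 t) \<le>
        11189 * (?c 14 * ?e 14)"
      by (rule drop[OF e(14) c]) (use t in simp)
    have b15: "?c 15 * (?n * abel_sum 13429820 101660780 462081660 1488385020 3952770812 9111248636 t)
        \<le> 11189 * (?c 15 * ?e 15)"
      by (rule drop[OF e(15) c]) (use t in simp)
    have b16: "?c 16 * (?n * abel_sum 32615496 247116264 1125119688 3638208456 9728459208 22691131848
        t) \<le> 11189 * (?c 16 * ?e 16)"
      by (rule drop[OF e(16) c]) (use t in simp)
    have b17: "?c 17 * (?n * abel_sum 76790868 582220644 2654252820 8608213908 23137096852 54445298836
        t) \<le> 11189 * (?c 17 * ?e 17)"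
      by (rule drop[OF e(17) c]) (use t in simp)
    have b18: "?c 18 * (?n * abel_sum 176753760 1340851424 6118827872 19889827680 53672617824
        127157598048 t) \<le> 11189 * (?c 18 * ?e 18)"
      by (rule drop[OF e(18) c]) (use t in simp)
    have b19: "?c 19 * (?n * abel_sum 399907948 3034992220 13860790188 45137146668 122183875116
        291005291052 t) \<le> 11189 * (?c 19 * ?e 19)"
      by (rule drop[OF e(19) c]) (use t in simp)
    have b20: "?c 20 * (?n * abel_sum 892677240 6777067480 30970533880 101000853240 274090544376
        655562030328 t) \<le> 11189 * (?c 20 * ?e 20)"
      by (rule drop[OF e(20) c]) (use t in simp)
    have "0 \<le> ?n * (w0 * weighted_sum u 3 [1841, 2124, 0, - 5520, - 14996, - 26712, - 31564, 0,
        149772, 626712, 1939492, 5286960, 13429820, 32615496, 76790868, 176753760, 399907948, 892677240] +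
        w1 * weighted_sum u 3 [6665, 12576, 0, - 38752, - 108260, - 196088, - 234172, 0, 1124220,
            4719608, 14639476, 39972592, 101660780, 247116264, 582220644, 1340851424, 3034992220,
            6777067480] +
        w2 * weighted_sum u 3 [13577, 27552, 0, - 150496, - 447636, - 839576, - 1024140, 0, 5029452,
            21245336, 66185700, 181278256, 462081660, 1125119688, 2654252820, 6118827872, 13860790188,
            30970533880] +
        w3 * weighted_sum u 3 [22409, 46688, 0, - 293280, - 1110036, - 2318232, - 2998284, 0,
            15599052, 66887832, 210532452, 580841520, 1488385020, 3638208456, 8608213908, 19889827680,
            45137146668, 101000853240] +
        w4 * weighted_sum u 3 [31625, 66656, 0, - 442272, - 1801236, - 4608408, - 6677260, 0,
            38708428, 170557080, 546841956, 1528310832, 3952770812, 9728459208, 23137096852,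
            53672617824, 122183875116, 274090544376] +
        w5 * weighted_sum u 3 [37769, 79968, 0, - 541600, - 2262036, - 6135192, - 11039500, 0,
            78939340, 365702808, 1212163428, 3466116144, 9111248636, 22691131848, 54445298836,
            127157598048, 291005291052, 655562030328])"
      using w pos v(2) unfolding v(1) w_defs
      by (intro mult_nonneg_nonneg add_nonneg_nonneg weighted_sum_nonneg_0 weighted_sum_nonneg_1
          weighted_sum_nonneg_2 weighted_sum_nonneg_3 weighted_sum_nonneg_4 weighted_sum_nonneg_5) auto
    also have "\<dots> = ?c 3 * (?n * abel_sum 1841 6665 13577 22409 31625 37769 t) +
        ?c 4 * (?n * abel_sum 2124 12576 27552 46688 66656 79968 t) +
        ?c 6 * (?n * abel_sum (- 5520) (- 38752) (- 150496) (- 293280) (- 442272) (- 541600) t) +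
        ?c 7 * (?n * abel_sum (- 14996) (- 108260) (- 447636) (- 1110036) (- 1801236) (- 2262036) t) +
        ?c 8 * (?n * abel_sum (- 26712) (- 196088) (- 839576) (- 2318232) (- 4608408) (- 6135192) t) +
        ?c 9 * (?n * abel_sum (- 31564) (- 234172) (- 1024140) (- 2998284) (- 6677260) (- 11039500) t) +
        ?c 11 * (?n * abel_sum 149772 1124220 5029452 15599052 38708428 78939340 t) +
        ?c 12 * (?n * abel_sum 626712 4719608 21245336 66887832 170557080 365702808 t) +
        ?c 13 * (?n * abel_sum 1939492 14639476 66185700 210532452 546841956 1212163428 t) +
        ?c 14 * (?n * abel_sum 5286960 39972592 181278256 580841520 1528310832 3466116144 t) +
        ?c 15 * (?n * abel_sum 13429820 101660780 462081660 1488385020 3952770812 9111248636 t) +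
        ?c 16 * (?n * abel_sum 32615496 247116264 1125119688 3638208456 9728459208 22691131848 t) +
        ?c 17 * (?n * abel_sum 76790868 582220644 2654252820 8608213908 23137096852 54445298836 t) +
        ?c 18 * (?n * abel_sum 176753760 1340851424 6118827872 19889827680 53672617824 127157598048 t) +
        ?c 19 * (?n * abel_sum 399907948 3034992220 13860790188 45137146668 122183875116 291005291052 t) +
        ?c 20 * (?n * abel_sum 892677240 6777067480 30970533880 101000853240 274090544376 655562030328 t)"
      unfolding abel by (simp add: algebra_simps)
    also have "\<dots> \<le> 11189 * (?c 3 * ?e 3) + 11189 * (?c 4 * ?e 4) + 11189 * (?c 6 * ?e 6) +
        11189 * (?c 7 * ?e 7) + 11189 * (?c 8 * ?e 8) + 11189 * (?c 9 * ?e 9) +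
        11189 * (?c 11 * ?e 11) + 11189 * (?c 12 * ?e 12) + 11189 * (?c 13 * ?e 13) +
        11189 * (?c 14 * ?e 14) + 11189 * (?c 15 * ?e 15) + 11189 * (?c 16 * ?e 16) +
        11189 * (?c 17 * ?e 17) + 11189 * (?c 18 * ?e 18) + 11189 * (?c 19 * ?e 19) +
        11189 * (?c 20 * ?e 20)"
      by (intro add_mono b3 b4 b6 b7 b8 b9 b11 b12 b13 b14 b15 b16 b17 b18 b19 b20)
    finally show ?thesis by (simp add: algebra_simps)
  qed
  ultimately show ?thesis by linarith
qed

text \<open>
  The Taylor coefficients are negative here, and so is the error. Only the term with \<open>k = 4\<close> has the
  wrong sign, and its quotient by \<open>node_poly\<close> is constant. The quotients of the later ones are at
  least their values at \<open>0\<close>, and the ratios of consecutive Taylor coefficients decrease to those for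
  \<open>u = -1\<close> as \<open>u\<close> does, so that a single numerical inequality remains. It needs all terms up to
  \<open>k = 11\<close>.
\<close>
lemma kernel_error_35_nonpos:
  assumes u: "- 1 < u" "u < 0" and x: "0 \<le> x" "x < 4"
  shows "kernel_error scheme35 u x \<le> 0"
proof (cases "x \<in> {0, 1, 2}")
  case True
  then show ?thesis using kernel_error_touch[OF True scheme35_touch[OF True]] by simp
next
  case False
  let ?d = "\<lambda>k. - kernel_coeff u k" and ?e = "\<lambda>k. power_error scheme35 k x" and ?n = "node_poly x"
  have pos: "0 < ?n" using False x by (intro node_poly_pos) auto
  have d: "0 \<le> ?d k" for k using kernel_coeff_nonpos[OF u] by simp
  have e_ge: "?n * (b / m) \<le> ?e k" if "m * ?e k = ?n * (b + r)" "0 < m" "0 \<le> r" for b k m r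
  proof -
    have "m * ?e k = ?n * b + ?n * r" using that(1) by (simp add: algebra_simps)
    moreover have "0 \<le> ?n * r" using that(3) pos by simp
    ultimately have "?n * b \<le> m * ?e k" by linarith
    then show ?thesis using that(2) by (simp add: field_simps)
  qed
  have e6: "0 < ?e 6"
  proof -
    have "0 < 6 * ?e 6" unfolding power_error_35 using pos x by (intro mult_pos_pos) auto
    then show ?thesis by simp
  qed
  have nonneg: "0 \<le> ?d k * ?e k" if "k \<noteq> 4" for k
  proof (cases "k < 6")
    case True
    then have "k \<in> {0, 1, 2, 3, 5}" using that by auto
    then show ?thesis using power_error_35 by (auto simp: kernel_coeff_def)
  next
    case ge: False
    have "0 \<le> ?e k"
      using False x ge power_error_35
      by (intro power_error_nonneg[where N = "{1, 2, 3, 5}" and r = 6, OF _ _ _ _ _ _ e6]) auto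
    then show ?thesis by (intro mult_nonneg_nonneg d)
  qed
  have "(\<Sum>k\<in>{4, 6, 7, 8, 9, 10, 11}. ?d k * ?e k) \<le> - kernel_error scheme35 u x"
    using sums_minus[OF kernel_error_sums[OF x, of u scheme35]] nonneg
    by (intro sum_le_sums) auto
  moreover have "0 \<le> (\<Sum>k\<in>{4, 6, 7, 8, 9, 10, 11}. ?d k * ?e k)"
  proof -
    have step: "?d k * ((real k - 1) / (4 * (real k + 1))) \<le> ?d (Suc k)" if "1 \<le> k" for k
    proof -
      have "(real k - 1) / (4 * (real k + 1)) \<le> (u + k) / (4 * (real k + 1))"
        using u by (intro divide_right_mono) auto
      then show ?thesis
        using mult_left_mono[OF _ d[of k]] unfolding kernel_coeff_Suc[OF that] by fastforce
    qed
    have d_ge: "3 / 20 * ?d 4 \<le> ?d 5" "4 / 24 * ?d 5 \<le> ?d 6" "5 / 28 * ?d 6 \<le> ?d 7"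
      "6 / 32 * ?d 7 \<le> ?d 8" "7 / 36 * ?d 8 \<le> ?d 9" "8 / 40 * ?d 9 \<le> ?d 10" "9 / 44 * ?d 10 \<le> ?d 11"
      using step[of 4] step[of 5] step[of 6] step[of 7] step[of 8] step[of 9] step[of 10] by simp_all
    have e: "?n * (- 1 / 6) \<le> ?e 4" "?n * (13 / 6) \<le> ?e 6" "?n * 11 \<le> ?e 7" "?n * (77 / 2) \<le> ?e 8"
      "?n * 114 \<le> ?e 9" "?n * (1841 / 6) \<le> ?e 10" "?n * 777 \<le> ?e 11"
      using power_error_35(5)[of x] e_ge[OF power_error_35(6)[unfolded add.assoc]] e_ge[where m = 1,
          unfolded mult_1, OF power_error_35(7)[unfolded add.assoc]]
        e_ge[OF power_error_35(8)[unfolded add.assoc]] e_ge[where m = 1, unfolded mult_1,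
            OF power_error_35(9)[unfolded add.assoc]]
        e_ge[OF power_error_35(10)[unfolded add.assoc]] e_ge[where m = 1, unfolded mult_1,
            OF power_error_35(11)[unfolded add.assoc]] x
      by simp_all
    have "0 \<le> ?n * (- 1 / 6 * ?d 4 + 13 / 6 * ?d 6 + 11 * ?d 7 + 77 / 2 * ?d 8 + 114 * ?d 9 +
        1841 / 6 * ?d 10 + 777 * ?d 11)"
    proof (rule mult_nonneg_nonneg)
      show "0 \<le> - 1 / 6 * ?d 4 + 13 / 6 * ?d 6 + 11 * ?d 7 + 77 / 2 * ?d 8 + 114 * ?d 9 +
          1841 / 6 * ?d 10 + 777 * ?d 11"
        using d_ge d[of 4] by linarith
    qed (use pos in simp)
    also have "\<dots> = ?d 4 * (?n * (- 1 / 6)) + ?d 6 * (?n * (13 / 6)) + ?d 7 * (?n * 11) +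
        ?d 8 * (?n * (77 / 2)) + ?d 9 * (?n * 114) + ?d 10 * (?n * (1841 / 6)) + ?d 11 * (?n * 777)"
      by (simp add: algebra_simps)
    also have "\<dots> \<le> ?d 4 * ?e 4 + ?d 6 * ?e 6 + ?d 7 * ?e 7 + ?d 8 * ?e 8 + ?d 9 * ?e 9 +
        ?d 10 * ?e 10 + ?d 11 * ?e 11"
      by (intro add_mono mult_left_mono e d)
    finally show ?thesis by simp
  qed
  ultimately show ?thesis by linarith
qed

section \<open>Forcing\<close>

lemma R_eq_kernel:
  assumes "0 < r"
  shows "R s r = sgn s * 4 powr (- (s / 2)) * (1 - (4 - r\<^sup>2) / 4) powr (- (s / 2))"
proof -
  have eq: "1 - (4 - r\<^sup>2) / 4 = r\<^sup>2 / 4" by (simp add: field_simps)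
  have "4 powr (- (s / 2)) * (1 - (4 - r\<^sup>2) / 4) powr (- (s / 2)) = (r\<^sup>2) powr (- (s / 2))"
    unfolding eq using assms by (simp flip: powr_mult)
  also have "\<dots> = r powr (- s)"
    using assms by (simp add: powr_powr flip: powr_numeral)
  finally show ?thesis by (simp only: R_def mult.assoc)
qed

lemma R_minus_interpolant:
  assumes "0 < r"
  shows "R s r - sgn s * 4 powr (- (s / 2)) * (1 + (\<Sum>(e, m)\<leftarrow>L. on_kernel m (s / 2) * G e r)) =
    sgn s * 4 powr (- (s / 2)) * kernel_error L (s / 2) (4 - r\<^sup>2)"
  by (simp add: R_eq_kernel[OF assms] kernel_error_def G_def algebra_simps)

text \<open>
  The error hypothesis says that \<open>R s\<close>, up to the factor \<open>4 powr (- (s / 2))\<close>, lies above its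
  interpolant; \<open>comb\<close> rewrites the interpolant in terms of the potentials of the triple at hand.
\<close>
lemma forcing_by_scheme:
  assumes X: "config5 X"
    and L: "\<And>k x. x \<in> {0, 1, 2} \<Longrightarrow> 0 < k \<Longrightarrow> power_error L k x = 0"
    and err: "\<And>x. 0 \<le> x \<Longrightarrow> x < 4 \<Longrightarrow> 0 \<le> sgn s * kernel_error L (s / 2) x"
    and comb: "\<And>r. sgn s * (\<Sum>(e, m)\<leftarrow>L. on_kernel m (s / 2) * G e r) =
      c1 * G 1 r + c2 * \<Gamma>2 r + c3 * \<Gamma>3 r + c4 * \<Gamma>4 r"
    and c: "0 \<le> c1" "0 \<le> c2" "0 \<le> c3" "0 \<le> c4" "0 < c2 + c3 + c4"
    and more: "energy \<Gamma>2 TBP < energy \<Gamma>2 X" "energy \<Gamma>3 TBP < energy \<Gamma>3 X"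
      "energy \<Gamma>4 TBP < energy \<Gamma>4 X"
  shows "energy (R s) TBP < energy (R s) X"
proof -
  define K where "K = 4 powr (- (s / 2))"
  have K: "0 < K" by (simp add: K_def)
  have diff: "R s r - (K * sgn s + K * c1 * G 1 r + K * c2 * \<Gamma>2 r + K * c3 * \<Gamma>3 r + K * c4 * \<Gamma>4 r) =
      K * (sgn s * kernel_error L (s / 2) (4 - r\<^sup>2))" if "0 < r" for r
  proof -
    have "K * sgn s + K * c1 * G 1 r + K * c2 * \<Gamma>2 r + K * c3 * \<Gamma>3 r + K * c4 * \<Gamma>4 r =
        K * (sgn s + (c1 * G 1 r + c2 * \<Gamma>2 r + c3 * \<Gamma>3 r + c4 * \<Gamma>4 r))"
      by (simp add: algebra_simps)
    also have "\<dots> = sgn s * K * (1 + (\<Sum>(e, m)\<leftarrow>L. on_kernel m (s / 2) * G e r))"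
      unfolding comb[symmetric] by (simp add: algebra_simps)
    finally show ?thesis
      using R_minus_interpolant[OF that, of s L] by (simp add: K_def mult_ac)
  qed
  show ?thesis
  proof (rule interpolation_forces[OF X _ _ _ _ _ _ _ more])
    fix r :: real
    assume r: "0 < r" "r \<le> 2"
    then have "r\<^sup>2 \<le> 2\<^sup>2" by (intro power_mono) auto
    then have "0 \<le> K * (sgn s * kernel_error L (s / 2) (4 - r\<^sup>2))"
      using r K by (intro mult_nonneg_nonneg err) auto
    then show "K * sgn s + K * c1 * G 1 r + K * c2 * \<Gamma>2 r + K * c3 * \<Gamma>3 r + K * c4 * \<Gamma>4 r \<le> R s r"
      using diff[OF r(1)] by linarith
  next
    fix r :: real
    assume r: "r \<in> {sqrt 2, sqrt 3, 2}"
    then have "0 < r" "4 - r\<^sup>2 \<in> {0, 1, 2}" by auto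
    then show "K * sgn s + K * c1 * G 1 r + K * c2 * \<Gamma>2 r + K * c3 * \<Gamma>3 r + K * c4 * \<Gamma>4 r = R s r"
      using diff[of r] kernel_error_touch[OF _ L, of "4 - r\<^sup>2" "s / 2"] by simp
  next
    have "0 < K * (c2 + c3 + c4)" using K c by simp
    then show "0 < K * c2 + K * c3 + K * c4" by (simp add: algebra_simps)
  qed (use K c in auto)
qed

theorem lemma2p1p1:
  "forcing (G 2, G 4, G 6) {0<..6} \<and>
   forcing (G 2, G 5, G10_sharp2) {6..13} \<and>
   forcing (G 2, G5_flat, G10_sharp) {13..15.05} \<and>
   forcing (G 2, G 3, G 5) {-2<..<0}"
proof (intro conjI)
  show "forcing (G 2, G 4, G 6) {0<..6}"
    unfolding forcing_def prod.case
  proof (intro allI impI ballI)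
    fix X s
    assume X: "config5 X" and s: "s \<in> {0<..6::real}"
      and more: "energy (G 2) TBP < energy (G 2) X \<and> energy (G 4) TBP < energy (G 4) X \<and>
        energy (G 6) TBP < energy (G 6) X"
    have u: "0 < s / 2" "s / 2 \<le> 3" using s by auto
    show "energy (R s) TBP < energy (R s) X"
    proof (rule forcing_by_scheme[OF X scheme46_touch])
      show "0 \<le> sgn s * kernel_error scheme46 (s / 2) x" if "0 \<le> x" "x < 4" for x
        using s kernel_error_46_nonneg[OF u(1) that] by simp
      show "sgn s * (\<Sum>(e, m)\<leftarrow>scheme46. on_kernel m (s / 2) * G e r) =
          on_kernel coeff46_1 (s / 2) * G 1 r + on_kernel coeff46_2 (s / 2) * G 2 r +
          on_kernel coeff46_4 (s / 2) * G 4 r + on_kernel coeff46_6 (s / 2) * G 6 r" for r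
        using s by (simp add: scheme46_def)
    qed (use more coeff46_1_pos[OF u] coeff46_2_pos[OF u] coeff46_4_pos[OF u] coeff46_6_nonneg[OF
        u(1)] in auto)
  qed
next
  show "forcing (G 2, G 5, G10_sharp2) {6..13}"
    unfolding forcing_def prod.case
  proof (intro allI impI ballI)
    fix X s
    assume X: "config5 X" and s: "s \<in> {6..13::real}"
      and more: "energy (G 2) TBP < energy (G 2) X \<and> energy (G 5) TBP < energy (G 5) X \<and>
        energy G10_sharp2 TBP < energy G10_sharp2 X"
    have u: "3 \<le> s / 2" "s / 2 \<le> 13 / 2" using s by auto
    let ?a = "\<lambda>m. on_kernel m (s / 2)"
    show "energy (R s) TBP < energy (R s) X"
    proof (rule forcing_by_scheme[OF X scheme510_touch])
      show "0 \<le> sgn s * kernel_error scheme510 (s / 2) x" if "0 \<le> x" "x < 4" for x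
        using s kernel_error_510_nonneg[OF u(1) that] by simp
      show "sgn s * (\<Sum>(e, m)\<leftarrow>scheme510. on_kernel m (s / 2) * G e r) =
          ?a coeff510_1 * G 1 r + (?a coeff510_2 - 102 * ?a coeff510_10) * G 2 r +
          (?a coeff510_5 - 28 * ?a coeff510_10) * G 5 r + ?a coeff510_10 * G10_sharp2 r" for r
        using s by (simp add: scheme510_def G10_sharp2_def algebra_simps)
    qed (use more coeff510_1_pos[OF u] coeff510_2_gt[OF u] coeff510_5_gt[OF u] coeff510_10_pos[OF
        u(1)] in auto)
  qed
next
  show "forcing (G 2, G5_flat, G10_sharp) {13..15.05}"
    unfolding forcing_def prod.case
  proof (intro allI impI ballI)
    fix X s
    assume X: "config5 X" and s: "s \<in> {13..15.05::real}"
      and more: "energy (G 2) TBP < energy (G 2) X \<and> energy G5_flat TBP < energy G5_flat X \<and>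
        energy G10_sharp TBP < energy G10_sharp X"
    have u: "3 \<le> s / 2" "13 / 2 \<le> s / 2" "s / 2 \<le> 301 / 40" using s by auto
    let ?a = "\<lambda>m. on_kernel m (s / 2)"
    show "energy (R s) TBP < energy (R s) X"
    proof (rule forcing_by_scheme[OF X scheme510_touch])
      show "0 \<le> sgn s * kernel_error scheme510 (s / 2) x" if "0 \<le> x" "x < 4" for x
        using s kernel_error_510_nonneg[OF u(1) that] by simp
      show "sgn s * (\<Sum>(e, m)\<leftarrow>scheme510. on_kernel m (s / 2) * G e r) =
          (?a coeff510_1 + 25 * (?a coeff510_5 - 13 * ?a coeff510_10)) * G 1 r +
          (?a coeff510_2 - 68 * ?a coeff510_10) * G 2 r +
          (?a coeff510_5 - 13 * ?a coeff510_10) * G5_flat r + ?a coeff510_10 * G10_sharp r" for r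
        using s by (simp add: scheme510_def G5_flat_def G10_sharp_def algebra_simps)
    qed (use more coeff510_1_sharp_pos[OF u(2,3)] coeff510_2_sharp_gt[OF u(2,3)]
        coeff510_5_sharp_gt[OF u(2,3)]
        coeff510_10_pos[OF u(1)] in auto)
  qed
next
  show "forcing (G 2, G 3, G 5) {-2<..<0}"
    unfolding forcing_def prod.case
  proof (intro allI impI ballI)
    fix X s
    assume X: "config5 X" and s: "s \<in> {-2<..<0::real}"
      and more: "energy (G 2) TBP < energy (G 2) X \<and> energy (G 3) TBP < energy (G 3) X \<and>
        energy (G 5) TBP < energy (G 5) X"
    have u: "- 1 < s / 2" "s / 2 < 0" using s by auto
    show "energy (R s) TBP < energy (R s) X"
    proof (rule forcing_by_scheme[OF X scheme35_touch])
      show "0 \<le> sgn s * kernel_error scheme35 (s / 2) x" if "0 \<le> x" "x < 4" for x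
        using s kernel_error_35_nonpos[OF u that] by simp
      show "sgn s * (\<Sum>(e, m)\<leftarrow>scheme35. on_kernel m (s / 2) * G e r) =
          - on_kernel coeff35_1 (s / 2) * G 1 r + - on_kernel coeff35_2 (s / 2) * G 2 r +
          - on_kernel coeff35_3 (s / 2) * G 3 r + - on_kernel coeff35_5 (s / 2) * G 5 r" for r
        using s by (simp add: scheme35_def algebra_simps)
    qed (use more coeff35_1_neg[OF u] coeff35_2_nonpos[OF u] coeff35_3_neg[OF u] coeff35_5_neg[OF u]
        in auto)
  qed
qed

end
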